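(* Let $k\ge1$ be an integer. The space $\mathcal U^{(1),k}_0(\Omega)\subset H(\mathrm{curl},\Omega)$ admits a discrete Helmholtz decomposition: every $v\in\mathcal U_0^{(1),k}(\Omega)$ can be written as $v=\nabla q+w$ with $q\in\mathcal U_0^{(0),k}(\Omega)$ and $w\in\mathcal U^{(1),k}_{0,\mathrm{curl}}(\Omega)$.
   Context: Finite pyramid: $\Omega=\{(\xi,\eta,\zeta)\in\mathbb R^3:\xi,\eta,\zeta\ge0,\ \xi\le1-\zeta,\ \eta\le1-\zeta\}$. Infinite pyramid: $\Omega_\infty=\{(x,y,z): 0\le x,y\le1,\ z\ge0\}$ (together with a point $\infty$). Map: $\phi:\Omega_\infty\to\Omega$, $\phi(x,y,z)=\left(\frac{x}{1+z},\frac{y}{1+z},\frac{z}{1+z}\right)$, a diffeomorphism onto $\Omega$ minus its apex $(0,0,1)$. Pullbacks: 0-forms $\phi^*u=u\circ\phi$; 1-forms $\phi^*E=D\phi^T(E\circ\phi)$; $(\phi^{-1})^*=(\phi^* )^{-1}$. $Q^{l,m,n}$: polynomials of degree at most $l,m,n$ in $x,y,z$; $Q^{l,m,n}_k=\{u/(1+z)^k:u\in Q^{l,m,n}\}$; $P^n_k[w,z]=\{u(w,z)/(1+z)^k:u$ polynomial of total degree $\le n\}$; $\tilde P^{k-1}_{k+1}[w,1+z]=\frac{1}{(1+z)^{k+1}}\mathrm{span}\{w^a(1+z)^{k-1-a}:0\le a\le k-1\}$. Polynomial spaces with a negative degree are $\{0\}$. $\mathcal U^{(0),k}(\Omega_\infty)$: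 all $u\in Q_k^{k,k,k-1}\oplus\mathrm{span}\{z^k/(1+z)^k\}$ whose restrictions to $y=0,1$ lie in $P_k^k[x,z]$ and to $x=0,1$ lie in $P_k^k[y,z]$. $\mathcal U^{(0),k}(\Omega)=(\phi^{-1})^*\mathcal U^{(0),k}(\Omega_\infty)$, and $\mathcal U_0^{(0),k}(\Omega)$ is the subspace of functions vanishing on $\partial\Omega$. $\mathcal U^{(1),k}(\Omega_\infty)$: all $u\in Q_{k+1}^{k-1,k,k-1}\times Q_{k+1}^{k,k-1,k-1}\times Q_{k+1}^{k,k,k-2}\oplus\{\frac{z^{k-1}}{(1+z)^{k+1}}(r_xz,r_yz,-r)^T:r\in Q^{k,k}[x,y]\}$ (subscripts on $r$ are partial derivatives) such that on $y=0,1$ (with $w=x$) $(u_1,u_3)\in(P^{k-1}_{k+1}[w,z])^2\oplus\tilde P^{k-1}_{k+1}[w,1+z](1+z,-w)^T$, and on $x=0,1$ (with $w=y$) $(u_2,u_3)$ lies in the same space. $\mathcal U^{(1),k}(\Omega)=(\phi^{-1})^*\mathcal U^{(1),k}(\Omega_\infty)$, and $\mathcal U_0^{(1),k}(\Omega)$ is the subspace of fields with zero tangential component on $\partial\Omega$. $\mathcal U^{(1),k}_{0,\mathrm{curl}}(\Omega)=(\phi^{-1})^*\mathcal U^{(1),k}_{0,\mathrm{curl}}(\Omega_\infty)$, where $\mathcal U^{(1),k}_{0,\mathrm{curl}}(\Omega_\infty)$ consists of the fields $\big(y(1-y)zq_1,\ x(1-x)zq_2,\ x(1-x)y(1-y)\rho\big)^T$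 with $q_1\in Q_{k+1}^{k-1,k-2,k-2}$, $q_2\in Q_{k+1}^{k-2,k-1,k-2}$, $\rho\in Q_{k+1}^{k-2,k-2,0}$ (i.e. $\rho=\frac{r(x,y)}{(1+z)^{k+1}}$ with $r\in Q^{k-2,k-2}[x,y]$). *)

theory Defs
  imports "HOL-Analysis.Analysis"
begin

text \<open>
  The pyramid, the infinite pyramid, and the map between them. The point at infinity is not an
  element of the type; it corresponds to the apex, which is treated where it matters.
\<close>

definition pyramid :: "(real^3) set" where
  "pyramid = {p. 0 \<le> p$1 \<and> 0 \<le> p$2 \<and> 0 \<le> p$3 \<and> p$1 \<le> 1 - p$3 \<and> p$2 \<le> 1 - p$3}"

definition apex :: "real^3" where
  "apex = vector [0, 0, 1]"

definition pyramid_inf :: "(real^3) set" where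
  "pyramid_inf = {p. 0 \<le> p$1 \<and> p$1 \<le> 1 \<and> 0 \<le> p$2 \<and> p$2 \<le> 1 \<and> 0 \<le> p$3}"

definition phi :: "real^3 \<Rightarrow> real^3" where
  "phi p = vector [p$1 / (1 + p$3), p$2 / (1 + p$3), p$3 / (1 + p$3)]"

definition pullback0 :: "(real^3 \<Rightarrow> real^3) \<Rightarrow> (real^3 \<Rightarrow> real) \<Rightarrow> real^3 \<Rightarrow> real" where
  "pullback0 f u = u \<circ> f"

definition pullback1 :: "(real^3 \<Rightarrow> real^3) \<Rightarrow> (real^3 \<Rightarrow> real^3) \<Rightarrow> real^3 \<Rightarrow> real^3" where
  "pullback1 f E = (\<lambda>p. transpose (jacobian f (at p)) *v E (f p))"

text \<open>
  Polynomial spaces. Degrees are integers and exponents range over \<open>{..<nat (l + 1)}\<close>, so that a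
  negative degree gives the space containing only 0.
\<close>

definition Q :: "int \<Rightarrow> int \<Rightarrow> int \<Rightarrow> (real^3 \<Rightarrow> real) set" where
  "Q l m n = {u. \<exists>c :: nat \<Rightarrow> nat \<Rightarrow> nat \<Rightarrow> real. u = (\<lambda>p.
     \<Sum>i<nat (l + 1). \<Sum>j<nat (m + 1). \<Sum>s<nat (n + 1). c i j s * (p$1)^i * (p$2)^j * (p$3)^s)}"

definition Q2 :: "int \<Rightarrow> int \<Rightarrow> (real \<Rightarrow> real \<Rightarrow> real) set" where
  "Q2 l m = {r. \<exists>c :: nat \<Rightarrow> nat \<Rightarrow> real. r = (\<lambda>x y.
     \<Sum>i<nat (l + 1). \<Sum>j<nat (m + 1). c i j * x^i * y^j)}"

definition Qw :: "nat \<Rightarrow> int \<Rightarrow> int \<Rightarrow> int \<Rightarrow> (real^3 \<Rightarrow> real) set" where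
  "Qw k l m n = {\<lambda>p. u p / (1 + p$3)^k | u. u \<in> Q l m n}"

definition Pw :: "nat \<Rightarrow> int \<Rightarrow> (real \<Rightarrow> real \<Rightarrow> real) set" where
  "Pw k n = {f. \<exists>c :: nat \<Rightarrow> nat \<Rightarrow> real. f = (\<lambda>w z.
     (\<Sum>(i, j) \<in> {(i, j). int (i + j) \<le> n}. c i j * w^i * z^j) / (1 + z)^k)}"

text \<open>\<open>Pt k\<close> is the space $\tilde P^{k-1}_{k+1}[w,1+z]$.\<close>

definition Pt :: "nat \<Rightarrow> (real \<Rightarrow> real \<Rightarrow> real) set" where
  "Pt k = {f. \<exists>c :: nat \<Rightarrow> real. f = (\<lambda>w z.
     (\<Sum>a<k. c a * w^a * (1 + z)^(k - 1 - a)) / (1 + z)^(k + 1))}"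

text \<open>
  Elements of the spaces on the infinite pyramid are represented by global functions; only their
  values on \<^const>\<open>pyramid_inf\<close> are ever used.
\<close>

definition U0_inf :: "nat \<Rightarrow> (real^3 \<Rightarrow> real) set" where
  "U0_inf k = {u.
     (\<exists>q \<in> Qw k (int k) (int k) (int k - 1). \<exists>c.
        u = (\<lambda>p. q p + c * ((p$3)^k / (1 + p$3)^k))) \<and>
     (\<forall>b \<in> {0, 1}. \<exists>f \<in> Pw k (int k). \<forall>w \<in> {0..1}. \<forall>z\<ge>0. u (vector [w, b, z]) = f w z) \<and>
     (\<forall>b \<in> {0, 1}. \<exists>f \<in> Pw k (int k). \<forall>w \<in> {0..1}. \<forall>z\<ge>0. u (vector [b, w, z]) = f w z)}"

definition face_space1 :: "nat \<Rightarrow> ((real \<Rightarrow> real \<Rightarrow> real) \<times> (real \<Rightarrow> real \<Rightarrow> real)) set" where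
  "face_space1 k = {(\<lambda>w z. f w z + (1 + z) * h w z, \<lambda>w z. g w z - w * h w z) | f g h.
     f \<in> Pw (k + 1) (int k - 1) \<and> g \<in> Pw (k + 1) (int k - 1) \<and> h \<in> Pt k}"

definition U1_inf :: "nat \<Rightarrow> (real^3 \<Rightarrow> real^3) set" where
  "U1_inf k = {u.
     (\<exists>a \<in> Qw (k + 1) (int k - 1) (int k) (int k - 1).
      \<exists>b \<in> Qw (k + 1) (int k) (int k - 1) (int k - 1).
      \<exists>c \<in> Qw (k + 1) (int k) (int k) (int k - 2).
      \<exists>r \<in> Q2 (int k) (int k).
        u = (\<lambda>p. vector [a p, b p, c p] +
               ((p$3)^(k - 1) / (1 + p$3)^(k + 1)) *\<^sub>R
                 vector [deriv (\<lambda>x. r x (p$2)) (p$1) * p$3,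
                         deriv (\<lambda>y. r (p$1) y) (p$2) * p$3,
                         - r (p$1) (p$2)])) \<and>
     (\<forall>b \<in> {0, 1}. \<exists>(f, g) \<in> face_space1 k. \<forall>w \<in> {0..1}. \<forall>z\<ge>0.
        u (vector [w, b, z]) $ 1 = f w z \<and> u (vector [w, b, z]) $ 3 = g w z) \<and>
     (\<forall>b \<in> {0, 1}. \<exists>(f, g) \<in> face_space1 k. \<forall>w \<in> {0..1}. \<forall>z\<ge>0.
        u (vector [b, w, z]) $ 2 = f w z \<and> u (vector [b, w, z]) $ 3 = g w z)}"

definition U1_curl0_inf :: "nat \<Rightarrow> (real^3 \<Rightarrow> real^3) set" where
  "U1_curl0_inf k = {\<lambda>p. vector [p$2 * (1 - p$2) * p$3 * q1 p,
                                p$1 * (1 - p$1) * p$3 * q2 p,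
                                p$1 * (1 - p$1) * p$2 * (1 - p$2) * \<rho> p] | q1 q2 \<rho>.
     q1 \<in> Qw (k + 1) (int k - 1) (int k - 2) (int k - 2) \<and>
     q2 \<in> Qw (k + 1) (int k - 2) (int k - 1) (int k - 2) \<and>
     \<rho> \<in> Qw (k + 1) (int k - 2) (int k - 2) 0}"

text \<open>
  The spaces on the finite pyramid: the preimages under the pullback along \<^const>\<open>phi\<close>. Since
  \<^const>\<open>phi\<close> maps onto the pyramid without its apex, the value of a 0-form at the apex is fixed
  by continuity (this is the value at the point at infinity), while 1-forms are fields on the
  pyramid without its apex. Values outside these domains are irrelevant.
\<close>

definition U0 :: "nat \<Rightarrow> (real^3 \<Rightarrow> real) set" where
  "U0 k = {u. (\<exists>g \<in> U0_inf k. \<forall>p \<in> pyramid_inf. pullback0 phi u p = g p) \<and>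
              continuous (at apex within pyramid) u}"

definition U0_0 :: "nat \<Rightarrow> (real^3 \<Rightarrow> real) set" where
  "U0_0 k = {u \<in> U0 k. \<forall>p \<in> frontier pyramid. u p = 0}"

definition U1 :: "nat \<Rightarrow> (real^3 \<Rightarrow> real^3) set" where
  "U1 k = {v. \<exists>E \<in> U1_inf k. \<forall>p \<in> pyramid_inf. pullback1 phi v p = E p}"

definition U1_curl0 :: "nat \<Rightarrow> (real^3 \<Rightarrow> real^3) set" where
  "U1_curl0 k = {v. \<exists>E \<in> U1_curl0_inf k. \<forall>p \<in> pyramid_inf. pullback1 phi v p = E p}"

text \<open>Outward normals \<open>n\<close> of the five faces, each face being \<open>{p \<in> pyramid. n \<bullet> p = c}\<close>.\<close>

definition pyramid_normals :: "((real^3) \<times> real) set" where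
  "pyramid_normals = {(vector [-1, 0, 0], 0), (vector [0, -1, 0], 0), (vector [0, 0, -1], 0),
                      (vector [1, 0, 1], 1), (vector [0, 1, 1], 1)}"

definition zero_tangential :: "(real^3 \<Rightarrow> real^3) \<Rightarrow> bool" where
  "zero_tangential v \<longleftrightarrow>
     (\<forall>(n, c) \<in> pyramid_normals. \<forall>p \<in> pyramid - {apex}. n \<bullet> p = c \<longrightarrow> cross3 n (v p) = 0)"

definition U1_0 :: "nat \<Rightarrow> (real^3 \<Rightarrow> real^3) set" where
  "U1_0 k = {v \<in> U1 k. zero_tangential v}"

text \<open>
  The gradient is taken relative to the set, so that it makes sense up to the boundary; it is unique
  because the pyramid is convex with nonempty interior.
\<close>

definition has_gradient_on :: "(real^3 \<Rightarrow> real) \<Rightarrow> (real^3 \<Rightarrow> real^3) \<Rightarrow> (real^3) set \<Rightarrow> bool" where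
  "has_gradient_on q g S \<longleftrightarrow> (\<forall>p \<in> S. (q has_derivative (\<lambda>h. g p \<bullet> h)) (at p within S))"

definition partial :: "3 \<Rightarrow> (real^3 \<Rightarrow> 'b::real_normed_vector) \<Rightarrow> real^3 \<Rightarrow> 'b" where
  "partial i f p = frechet_derivative f (at p) (axis i 1)"

definition curl :: "(real^3 \<Rightarrow> real^3) \<Rightarrow> real^3 \<Rightarrow> real^3" where
  "curl f p = vector [partial 2 f p $ 3 - partial 3 f p $ 2,
                      partial 3 f p $ 1 - partial 1 f p $ 3,
                      partial 1 f p $ 2 - partial 2 f p $ 1]"

primrec Ck :: "nat \<Rightarrow> (real^3 \<Rightarrow> 'b::real_normed_vector) \<Rightarrow> bool" where
  "Ck 0 f \<longleftrightarrow> continuous_on UNIV f"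
| "Ck (Suc n) f \<longleftrightarrow> f differentiable_on UNIV \<and> (\<forall>i. Ck n (partial i f))"

definition test_fields :: "(real^3) set \<Rightarrow> (real^3 \<Rightarrow> real^3) set" where
  "test_fields D = {\<psi>. (\<forall>n. Ck n \<psi>) \<and> compact (closure {p. \<psi> p \<noteq> 0}) \<and> closure {p. \<psi> p \<noteq> 0} \<subseteq> D}"

definition L2_fields :: "(real^3) set \<Rightarrow> (real^3 \<Rightarrow> real^3) set" where
  "L2_fields D = {v. v \<in> borel_measurable (lebesgue_on D) \<and>
                     integrable (lebesgue_on D) (\<lambda>p. (norm (v p))\<^sup>2)}"

text \<open>The space $H(\mathrm{curl}, D)$ for open \<open>D\<close>, with the curl in the weak sense.\<close>

definition Hcurl :: "(real^3) set \<Rightarrow> (real^3 \<Rightarrow> real^3) set" where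
  "Hcurl D = {v \<in> L2_fields D. \<exists>g \<in> L2_fields D. \<forall>\<psi> \<in> test_fields D.
     (\<integral>p. v p \<bullet> curl \<psi> p \<partial>lebesgue_on D) = (\<integral>p. g p \<bullet> \<psi> p \<partial>lebesgue_on D)}"

end

theory Submission
  imports Defs
begin

text \<open>
  Write $(1+z)^{k+1} E$ for the pullback $E$ of $v$ as polynomials in $z$ with coefficients in $x, y$.
  The zero trace makes the coefficients of $E_3$ vanish on the boundary of the unit square. For
  $u = \sum_{s<k} T_s(x,y) z^s / (1+z)^k$ the numerator of $\partial_z u$ has the coefficients
  $(s+1) T_{s+1} - (k-s) T_s$, so with $T_0 = T_k = 0$ the $T_s$ can be found from the top coefficient
  downwards such that $E_3 - \partial_z u$ has only a constant coefficient. The top coefficient of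
  $E$ is the special gradient-like term, which forces $T_{k-1} = r$ and so cancels the leading terms of
  $E_1 - \partial_x u$ and $E_2 - \partial_y u$; the remaining factors $y(1-y)z$ etc. come from the zero trace.

  For membership in $H(\mathrm{curl})$, the components of $v$ on the pyramid are polynomials in
  $\xi/(1-\zeta)$, $\eta/(1-\zeta)$, $\zeta$. Their derivatives are of order $1/(1-\zeta)$, which is
  square integrable since the cross sections have area $(1-\zeta)^2$, and the weak curl is the
  classical one by integration by parts against compactly supported fields.
\<close>

subsection \<open>Polynomials in two variables\<close>

text \<open>The conditions \<open>T 0 = 0\<close> (zero value on the base) and
  \<open>T k = 0\<close> (no term that survives at the apex) leave \<open>k - 1\<close> unknown
  coefficients against the \<open>k\<close> coefficients of the third component. The one equation
  that cannot be matched is that of degree 0. Its residue \<open>C 0 - T 1\<close> vanishes on the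
  boundary of the unit square, so division by \<open>x * (1 - x) * y * (1 - y)\<close> turns it into
  the numerator of \<open>\<rho>\<close>. For \<open>k = 1\<close> there is no unknown at all, and
  the cancellation of the special term demands that \<open>r\<close> itself be zero. This holds
  because a polynomial of bidegree (1,1) that vanishes on all four edges is zero. The potential has
  closed formulas on both pyramids. The gradient can therefore be taken on the finite one and
  computed on the infinite one, with the chain rule as the only link.\<close>

text \<open>A nonzero polynomial has finitely many roots. The set \<open>S\<close> is arbitrary
  because traces are known to vanish only on \<open>{0..1}\<close>, on its interior, or for
  nonnegative heights.\<close>

lemma real_polyfun_eq_0:
  fixes c :: "nat \<Rightarrow> real"
  assumes "infinite S" "\<And>z. z \<in> S \<Longrightarrow> (\<Sum>i<n. c i * z^i) = 0" "i < n"
  shows "c i = 0"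
proof (rule ccontr)
  assume "c i \<noteq> 0"
  obtain m where m: "n = Suc m" using assms(3) by (cases n) auto
  have "finite {z. (\<Sum>i\<le>m. c i * z^i) = 0}"
    by (subst polyfun_finite_roots) (use \<open>c i \<noteq> 0\<close> assms(3) m in \<open>auto simp: less_Suc_eq_le\<close>)
  moreover have "S \<subseteq> {z. (\<Sum>i\<le>m. c i * z^i) = 0}"
    using assms(2) by (auto simp: m lessThan_Suc_atMost)
  ultimately show False using assms(1) finite_subset by blast
qed

text \<open>Division with remainder by \<open>y * (1 - y)\<close>. Dividing by \<open>1 - y\<close>
  multiplies by the geometric series, so the quotient has partial sums as coefficients. The
  remainder is governed by the values at 0 and 1, namely \<open>c 0\<close> and the sum of all
  coefficients.\<close>

lemma sum_div_y_one_minus_y: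
  fixes c :: "nat \<Rightarrow> real"
  shows "(\<Sum>j<N+2. c j * y^j) = c 0 + y * (1-y) * (\<Sum>j<N. (\<Sum>i\<le>j. c (Suc i)) * y^j)
     + (\<Sum>i\<le>N. c (Suc i)) * y^(N+1)"
  by (induction N) (auto simp: algebra_simps power2_eq_square)

text \<open>Both remainders of the division vanish. For \<open>n\<close> equal to 0 or 1 the
  truncated \<open>n - 2\<close> leaves an empty quotient, which is right because the polynomial is
  then zero.\<close>

lemma polyfun_factor_y_one_minus_y:
  fixes c :: "nat \<Rightarrow> real"
  assumes "n > 0 \<Longrightarrow> c 0 = 0" "(\<Sum>j<n. c j) = 0"
  shows "(\<Sum>j<n. c j * y^j) = y * (1-y) * (\<Sum>j<n-2. (\<Sum>i\<le>j. c (Suc i)) * y^j)"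
proof -
  consider "n = 0" | "n = 1" | N where "n = N + 2"
    by (metis One_nat_def add_2_eq_Suc' not0_implies_Suc)
  then show ?thesis
  proof cases
    case 3
    have "(\<Sum>j<Suc (Suc N). c j) = c 0 + (\<Sum>i\<le>N. c (Suc i))"
      by (subst sum.lessThan_Suc_shift) (simp only: lessThan_Suc_atMost)
    then have "c 0 = 0" "(\<Sum>i\<le>N. c (Suc i)) = 0"
      using assms 3 by simp_all
    then show ?thesis unfolding 3 sum_div_y_one_minus_y by simp
  qed (use assms in auto)
qed

lemma Q2_I: "(\<lambda>x y. \<Sum>i<nat (l + 1). \<Sum>j<nat (m + 1). c i j * x^i * y^j) \<in> Q2 l m"
  unfolding Q2_def by blast

lemma Q2_zero: "(\<lambda>x y. 0) \<in> Q2 l m"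
  using Q2_I[where l = l and m = m and c = "\<lambda>i j. 0"] by simp

lemma Q2_lincomb:
  assumes "f \<in> Q2 l m" "g \<in> Q2 l m"
  shows "(\<lambda>x y. a * f x y + b * g x y) \<in> Q2 l m"
proof -
  obtain c d where f: "f = (\<lambda>x y. \<Sum>i<nat (l + 1). \<Sum>j<nat (m + 1). c i j * x^i * y^j)"
    and g: "g = (\<lambda>x y. \<Sum>i<nat (l + 1). \<Sum>j<nat (m + 1). d i j * x^i * y^j)"
    using assms unfolding Q2_def by blast
  show ?thesis
    unfolding f g using Q2_I[where l = l and m = m and c = "\<lambda>i j. a * c i j + b * d i j"]
    by (simp add: sum_distrib_left sum.distrib algebra_simps)
qed

lemma Q2_swap: "f \<in> Q2 l m \<Longrightarrow> (\<lambda>x y. f y x) \<in> Q2 m l"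
proof -
  assume "f \<in> Q2 l m"
  then obtain c where f: "f = (\<lambda>x y. \<Sum>i<nat (l + 1). \<Sum>j<nat (m + 1). c i j * x^i * y^j)"
    unfolding Q2_def by blast
  have "(\<lambda>x y. f y x) = (\<lambda>x y. \<Sum>j<nat (m + 1). \<Sum>i<nat (l + 1). c i j * x^j * y^i)"
    unfolding f by (subst sum.swap) (simp add: mult_ac)
  then show ?thesis using Q2_I[where l = m and m = l and c = "\<lambda>i j. c j i"] by simp
qed

lemma Q2_has_derivative_x:
  assumes "f \<in> Q2 l m"
  obtains fx where "fx \<in> Q2 (l - 1) m"
    "\<And>x y. ((\<lambda>x. f x y) has_real_derivative fx x y) (at x)"
proof -
  obtain c where f: "f = (\<lambda>x y. \<Sum>i<nat (l + 1). \<Sum>j<nat (m + 1). c i j * x^i * y^j)"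
    using assms unfolding Q2_def by blast
  define fx where "fx = (\<lambda>x y. \<Sum>i<nat (l - 1 + 1). \<Sum>j<nat (m + 1). (real (Suc i) * c (Suc i) j) * x^i * y^j)"
  have "fx \<in> Q2 (l - 1) m" unfolding fx_def by (rule Q2_I)
  moreover have "((\<lambda>x. f x y) has_real_derivative fx x y) (at x)" for x y
  proof -
    have "((\<lambda>x. f x y) has_real_derivative
        (\<Sum>i<nat (l + 1). \<Sum>j<nat (m + 1). c i j * (real i * x^(i-1)) * y^j)) (at x)"
      unfolding f by (auto intro!: derivative_eq_intros sum.cong)
    also have "(\<Sum>i<nat (l + 1). \<Sum>j<nat (m + 1). c i j * (real i * x^(i-1)) * y^j) = fx x y"
    proof (cases "l \<ge> 0")
      case True
      then have "nat (l + 1) = Suc (nat l)" by simp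
      then show ?thesis unfolding fx_def
        by (simp add: sum.lessThan_Suc_shift mult_ac del: sum.lessThan_Suc)
    qed (simp add: fx_def)
    finally show ?thesis .
  qed
  ultimately show thesis using that by blast
qed

lemma Q2_has_derivative_y:
  assumes "f \<in> Q2 l m"
  obtains fy where "fy \<in> Q2 l (m - 1)"
    "\<And>x y. ((\<lambda>y. f x y) has_real_derivative fy x y) (at y)"
proof -
  obtain g where "g \<in> Q2 (m - 1) l"
    and "\<And>y x. ((\<lambda>y. f x y) has_real_derivative g y x) (at y)"
    using Q2_has_derivative_x[OF Q2_swap[OF assms]] by metis
  then show thesis using that[of "\<lambda>x y. g y x"] Q2_swap by blast
qed

text \<open>Vanishing on part of an edge spreads to the whole line containing it. This permits
  differentiating along the edge, and recovering the corner values lost by a division.\<close>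

lemma Q2_slice_y_eq_0:
  assumes f: "f \<in> Q2 l m" and S: "infinite S" and 0: "\<And>x. x \<in> S \<Longrightarrow> f x b = 0"
  shows "f x b = 0"
proof -
  obtain c where f: "f = (\<lambda>x y. \<Sum>i<nat (l + 1). \<Sum>j<nat (m + 1). c i j * x^i * y^j)"
    using f unfolding Q2_def by blast
  have *: "f x b = (\<Sum>i<nat (l + 1). (\<Sum>j<nat (m + 1). c i j * b^j) * x^i)" for x
    unfolding f by (auto simp: sum_distrib_left sum_distrib_right mult_ac intro!: sum.cong)
  have "(\<Sum>j<nat (m + 1). c i j * b^j) = 0" if "i < nat (l + 1)" for i
    using real_polyfun_eq_0[OF S, where n = "nat (l + 1)" and c = "\<lambda>i. \<Sum>j<nat (m + 1). c i j * b^j"] 0 that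
    by (simp add: *)
  then show ?thesis by (simp add: *)
qed

text \<open>Read as a polynomial in \<open>x\<close>, \<open>f\<close> has coefficients depending on
  \<open>y\<close>. Each of them vanishes at 0 and 1 and is divisible by \<open>y * (1 - y)\<close>.
  For \<open>m < 2\<close> the quotient space contains only 0, so the lemma then says that
  \<open>f\<close> is zero.\<close>

lemma Q2_factor_y:
  assumes f: "f \<in> Q2 l m"
    and 0: "\<And>x b. x \<in> {0..1} \<Longrightarrow> b \<in> {0,1} \<Longrightarrow> f x b = 0"
  obtains g where "g \<in> Q2 l (m - 2)" "\<And>x y. f x y = y * (1 - y) * g x y"
proof -
  obtain c where c: "f = (\<lambda>x y. \<Sum>i<nat (l + 1). \<Sum>j<nat (m + 1). c i j * x^i * y^j)"
    using f unfolding Q2_def by blast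
  have *: "f x y = (\<Sum>i<nat (l + 1). (\<Sum>j<nat (m + 1). c i j * y^j) * x^i)" for x y
    unfolding c by (auto simp: sum_distrib_left sum_distrib_right mult_ac intro!: sum.cong)
  have inf: "infinite {0..1::real}" by (simp add: infinite_Icc)
  have z: "(\<Sum>j<nat (m + 1). c i j * b^j) = 0" if "i < nat (l + 1)" "b \<in> {0,1}" for i b
    using real_polyfun_eq_0[OF inf, where n = "nat (l + 1)" and c = "\<lambda>i. \<Sum>j<nat (m + 1). c i j * b^j"] 0 that
    by (simp add: *)
  have c0: "c i 0 = 0" if i: "i < nat (l + 1)" and m: "nat (m + 1) > 0" for i
  proof -
    obtain N where "nat (m + 1) = Suc N" using m gr0_implies_Suc by blast
    then show ?thesis using z[OF i, of 0]
      by (simp add: sum.lessThan_Suc_shift del: sum.lessThan_Suc)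
  qed
  have n: "nat (m - 2 + 1) = nat (m + 1) - 2" by linarith
  define g where "g = (\<lambda>x y. \<Sum>i<nat (l + 1). \<Sum>j<nat (m - 2 + 1). (\<Sum>t\<le>j. c i (Suc t)) * x^i * y^j)"
  have "g \<in> Q2 l (m - 2)" unfolding g_def by (rule Q2_I)
  moreover have "f x y = y * (1 - y) * g x y" for x y
  proof -
    have "f x y = (\<Sum>i<nat (l + 1). y * (1 - y) * (\<Sum>j<nat (m + 1) - 2. (\<Sum>t\<le>j. c i (Suc t)) * y^j) * x^i)"
      unfolding * using c0 z[of _ 1]
      by (intro sum.cong refl) (subst polyfun_factor_y_one_minus_y, auto)
    then show ?thesis
      unfolding g_def n by (simp add: sum_distrib_left sum_distrib_right mult_ac)
  qed
  ultimately show thesis using that by blast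
qed

lemma Q2_factor_x:
  assumes f: "f \<in> Q2 l m"
    and 0: "\<And>y b. y \<in> {0..1} \<Longrightarrow> b \<in> {0,1} \<Longrightarrow> f b y = 0"
  obtains g where "g \<in> Q2 (l - 2) m" "\<And>x y. f x y = x * (1 - x) * g x y"
proof -
  obtain g where "g \<in> Q2 m (l - 2)" "\<And>y x. f x y = x * (1 - x) * g y x"
    using Q2_factor_y[OF Q2_swap[OF f]] 0 by metis
  then show thesis using that[of "\<lambda>x y. g y x"] Q2_swap by blast
qed

lemma Q2_factor_xy:
  assumes f: "f \<in> Q2 l m"
    and "\<And>x b. x \<in> {0..1} \<Longrightarrow> b \<in> {0,1} \<Longrightarrow> f x b = 0"
    and "\<And>y b. y \<in> {0..1} \<Longrightarrow> b \<in> {0,1} \<Longrightarrow> f b y = 0"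
  obtains g where "g \<in> Q2 (l - 2) (m - 2)" "\<And>x y. f x y = x * (1 - x) * y * (1 - y) * g x y"
proof -
  obtain g where g: "g \<in> Q2 l (m - 2)" "\<And>x y. f x y = y * (1 - y) * g x y"
    using Q2_factor_y[OF f assms(2)] by blast
  have inf: "infinite {0<..<1::real}" by (simp add: infinite_Ioo)
  \<comment> \<open>At \<open>y = 0\<close> and \<open>y = 1\<close> the factor
    \<open>y * (1 - y)\<close> hides the value of \<open>g\<close>, so vanishing is first known on
    the open edge only.\<close>
  have g0: "g b y = 0" if "b \<in> {0,1}" for b y
  proof (rule Q2_slice_y_eq_0[OF Q2_swap[OF g(1)] inf])
    show "g b y = 0" if "y \<in> {0<..<1}" for y
      using assms(3)[of y b] g(2)[of b y] that \<open>b \<in> {0,1}\<close> by auto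
  qed
  obtain h where h: "h \<in> Q2 (l - 2) (m - 2)" "\<And>x y. g x y = x * (1 - x) * h x y"
    using Q2_factor_x[OF g(1)] g0 by blast
  then show thesis using that[OF h(1)] g(2) by (simp add: mult_ac)
qed

subsection \<open>Integration by parts\<close>

lemma has_derivative_imp_line_DERIV:
  fixes F :: "'a::euclidean_space \<Rightarrow> real"
  assumes "(F has_derivative F') (at (p + t *\<^sub>R e))"
  shows "((\<lambda>t. F (p + t *\<^sub>R e)) has_real_derivative F' e) (at t)"
proof -
  have "((\<lambda>t. p + t *\<^sub>R e) has_derivative (\<lambda>t. t *\<^sub>R e)) (at t)"
    by (auto intro!: derivative_eq_intros)
  from has_derivative_compose[OF this assms]
  have "((\<lambda>t. F (p + t *\<^sub>R e)) has_derivative (\<lambda>t. F' (t *\<^sub>R e))) (at t)" .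
  moreover have "F' (t *\<^sub>R e) = t * F' e" for t
    using has_derivative_linear[OF assms] by (simp add: linear_cmul)
  ultimately show ?thesis
    by (simp add: has_field_derivative_def mult_commute_abs)
qed

lemma lborel_integral_translation:
  fixes F :: "'a::euclidean_space \<Rightarrow> real"
  assumes "integrable lborel F"
  shows "integrable lborel (\<lambda>p. F (p + c))" "(\<integral>p. F (p + c) \<partial>lborel) = (\<integral>p. F p \<partial>lborel)"
proof -
  have [measurable]: "F \<in> borel_measurable borel" using assms by auto
  have "integrable (distr lborel borel ((+) c)) F"
    using assms by (simp add: lborel_distr_plus)
  then show "integrable lborel (\<lambda>p. F (p + c))"
    by (subst (asm) integrable_distr_eq) (auto simp: add.commute)
  have "(\<integral>p. F p \<partial>distr lborel borel ((+) c)) = (\<integral>p. F (c + p) \<partial>lborel)"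
    by (rule integral_distr) auto
  then show "(\<integral>p. F (p + c) \<partial>lborel) = (\<integral>p. F p \<partial>lborel)"
    by (simp add: lborel_distr_plus add.commute)
qed

text \<open>By translation invariance every difference quotient of \<open>F\<close> has integral
  zero. The quotients converge pointwise to the derivative and, by the mean value theorem, are
  bounded by \<open>M\<close> on one fixed compact set, so dominated convergence applies.\<close>

lemma integral_directional_derivative_eq_0:
  fixes F :: "'a::euclidean_space \<Rightarrow> real"
  assumes der: "\<And>p. (F has_derivative (\<lambda>h. G p \<bullet> h)) (at p)"
    and K: "compact K" "\<And>p. p \<notin> K \<Longrightarrow> F p = 0"
    and M: "\<And>p. \<bar>G p \<bullet> e\<bar> \<le> M"
  shows "(\<integral>p. G p \<bullet> e \<partial>lborel) = 0"
proof -
  have cont: "continuous_on UNIV F"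
    using der by (meson continuous_at_imp_continuous_on has_derivative_continuous)
  have [measurable]: "F \<in> borel_measurable borel"
    using cont by (rule borel_measurable_continuous_onI)
  have "F = (\<lambda>p. indicator K p *\<^sub>R F p)"
    using K(2) by (auto simp: indicator_def fun_eq_iff)
  then have intF: "integrable lborel F"
    using borel_integrable_compact[OF K(1) continuous_on_subset[OF cont subset_UNIV]] by simp
  define s where "s n p = real (Suc n) * (F (p + inverse (real (Suc n)) *\<^sub>R e) - F p)" for n p
  \<comment> \<open>The points from which a step of at most 1 in direction \<open>e\<close> can
    reach \<open>K\<close>. All steps used are \<open>inverse (Suc n) \<le> 1\<close>, so every
    difference quotient vanishes outside \<open>K'\<close>.\<close>
  define K' where "K' = (\<lambda>(x, t). x - t *\<^sub>R e) ` (K \<times> {0..1::real})"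
  have line: "((\<lambda>t. F (p + t *\<^sub>R e)) has_real_derivative G (p + t *\<^sub>R e) \<bullet> e) (at t)" for p t
    by (rule has_derivative_imp_line_DERIV[OF der])
  have K': "compact K'" unfolding K'_def
    by (intro compact_continuous_image compact_Times K)
       (auto intro!: continuous_intros simp: case_prod_unfold)
  have s_lim: "(\<lambda>n. s n p) \<longlonglongrightarrow> G p \<bullet> e" for p
  proof -
    have "((\<lambda>h. (F (p + h *\<^sub>R e) - F p) / h) \<longlongrightarrow> G p \<bullet> e) (at 0)"
      using line[where t = 0 and p = p] by (simp add: DERIV_def)
    moreover have "filterlim (\<lambda>n. inverse (real (Suc n))) (at 0) sequentially"
      using LIMSEQ_inverse_real_of_nat by (auto simp: filterlim_at)
    ultimately have "(\<lambda>n. (F (p + inverse (real (Suc n)) *\<^sub>R e) - F p) / inverse (real (Suc n))) \<longlonglongrightarrow> G p \<bullet> e"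
      by (rule filterlim_compose)
    then show ?thesis unfolding s_def by (simp only: divide_inverse inverse_inverse_eq mult.commute)
  qed
  have s_bound: "norm (s n p) \<le> indicator K' p *\<^sub>R M" for n p
  proof (cases "p \<in> K'")
    case True
    let ?t = "inverse (real (Suc n))"
    have "?t > 0" by simp
    then obtain z where "F (p + ?t *\<^sub>R e) - F (p + 0 *\<^sub>R e) = (?t - 0) * (G (p + z *\<^sub>R e) \<bullet> e)"
      using MVT2[of 0 ?t "\<lambda>t. F (p + t *\<^sub>R e)" "\<lambda>t. G (p + t *\<^sub>R e) \<bullet> e"] line by blast
    then have "s n p = real (Suc n) * (?t * (G (p + z *\<^sub>R e) \<bullet> e))"
      unfolding s_def by (simp only: scaleR_zero_left add_0_right diff_zero)
    then have "s n p = G (p + z *\<^sub>R e) \<bullet> e"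
      by (simp only: mult.assoc[symmetric]) (simp del: of_nat_Suc)
    then show ?thesis using True M by simp
  next
    case False
    have "p + t *\<^sub>R e \<notin> K" if "t \<in> {0..1}" for t
    proof
      assume "p + t *\<^sub>R e \<in> K"
      then have "p \<in> K'" unfolding K'_def using that
        by (intro image_eqI[of _ _ "(p + t *\<^sub>R e, t)"]) auto
      then show False using False by simp
    qed
    from this[of 0] this[of "inverse (real (Suc n))"] have "s n p = 0"
      unfolding s_def using K(2) by (simp add: inverse_le_1_iff)
    then show ?thesis using False by simp
  qed
  have [measurable]: "s n \<in> borel_measurable lborel" for n
    unfolding s_def by measurable
  have "(\<lambda>n. \<integral>p. s n p \<partial>lborel) \<longlonglongrightarrow> (\<integral>p. G p \<bullet> e \<partial>lborel)"
  proof (rule integral_dominated_convergence)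
    show "(\<lambda>p. G p \<bullet> e) \<in> borel_measurable lborel"
      by (rule borel_measurable_LIMSEQ_real[where u = s]) (use s_lim in auto)
    show "integrable lborel (\<lambda>p. indicator K' p *\<^sub>R M)"
      by (rule borel_integrable_compact[OF K']) auto
  qed (use s_lim s_bound in auto)
  moreover have "(\<integral>p. s n p \<partial>lborel) = 0" for n
    unfolding s_def
    by (simp add: lborel_integral_translation[OF intF] intF Bochner_Integration.integral_diff del: of_nat_Suc)
  ultimately have "(\<lambda>n::nat. 0) \<longlonglongrightarrow> (\<integral>p. G p \<bullet> e \<partial>lborel)" by simp
  then show ?thesis using LIMSEQ_unique[OF tendsto_const] by metis
qed

text \<open>Cutting off with the indicator of \<open>K\<close> gives a Borel function on the whole
  space, so integrals over \<open>D\<close> in the completed measure can be computed with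
  \<open>lborel\<close>, where translation invariance was used.\<close>

lemma lebesgue_on_integral_compact_support:
  fixes h :: "'a::euclidean_space \<Rightarrow> real"
  assumes "open D" "compact K" "K \<subseteq> D" "continuous_on K h" "\<And>p. p \<in> D - K \<Longrightarrow> h p = 0"
  shows "integrable (lebesgue_on D) h"
    "(\<integral>p. h p \<partial>lebesgue_on D) = (\<integral>p. indicator K p *\<^sub>R h p \<partial>lborel)"
proof -
  have D: "D \<inter> space lebesgue \<in> sets lebesgue" using assms(1) by simp
  have eq: "(\<lambda>p. indicator D p *\<^sub>R h p) = (\<lambda>p. indicator K p *\<^sub>R h p)"
    using assms(3,5) by (auto simp: indicator_def fun_eq_iff)
  have int: "integrable lborel (\<lambda>p. indicator K p *\<^sub>R h p)"
    by (rule borel_integrable_compact) fact+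
  show "integrable (lebesgue_on D) h"
    unfolding integrable_restrict_space[OF D] eq by (subst integrable_completion) (use int in auto)
  show "(\<integral>p. h p \<partial>lebesgue_on D) = (\<integral>p. indicator K p *\<^sub>R h p \<partial>lborel)"
    unfolding integral_restrict_space[OF D] eq by (rule integral_completion) (use int in auto)
qed

text \<open>The product of \<open>f\<close> and \<open>g\<close>, extended by zero, is
  differentiable on the whole space because \<open>g\<close> vanishes off a compact subset of
  \<open>D\<close>. The integral of its directional derivative is therefore zero. No bound on
  \<open>f\<close> near the boundary of \<open>D\<close> enters, which matters since the gradients
  in question blow up at the apex.\<close>

lemma integration_by_parts_compact_support:
  fixes f g :: "'a::euclidean_space \<Rightarrow> real"
  assumes D: "open D" and K: "compact K" "K \<subseteq> D" and g0: "\<And>p. p \<notin> K \<Longrightarrow> g p = 0"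
    and f: "\<And>p. p \<in> D \<Longrightarrow> (f has_derivative (\<lambda>h. f' p \<bullet> h)) (at p)" "continuous_on D f'"
    and g: "\<And>p. (g has_derivative (\<lambda>h. g' p \<bullet> h)) (at p)" "continuous_on UNIV g'"
  shows "integrable (lebesgue_on D) (\<lambda>p. f p * (g' p \<bullet> e))"
    "integrable (lebesgue_on D) (\<lambda>p. (f' p \<bullet> e) * g p)"
    "(\<integral>p. f p * (g' p \<bullet> e) \<partial>lebesgue_on D) = - (\<integral>p. (f' p \<bullet> e) * g p \<partial>lebesgue_on D)"
proof -
  have opK: "open (- K)" using K(1) compact_imp_closed by blast
  have zero_der: "(F has_derivative (\<lambda>h. 0 \<bullet> h)) (at p)"
    if "p \<notin> K" "\<And>p. p \<notin> K \<Longrightarrow> F p = 0" for F :: "'a \<Rightarrow> real" and p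
    by (rule has_derivative_transform_within_open[OF _ opK, of "\<lambda>_. 0"]) (use that in auto)
  have g'0: "g' p = 0" if "p \<notin> K" for p
  proof -
    have "(\<lambda>h. g' p \<bullet> h) = (\<lambda>h. 0 \<bullet> h)"
      by (rule has_derivative_unique[OF g(1) zero_der]) (use that g0 in auto)
    then have "g' p \<bullet> g' p = 0" by (metis inner_zero_left)
    then show ?thesis by simp
  qed
  have contf: "continuous_on K f"
    by (meson K(2) continuous_at_imp_continuous_on f(1) has_derivative_continuous in_mono)
  have contg: "continuous_on K g"
    using g(1) by (meson continuous_at_imp_continuous_on has_derivative_continuous)
  have contf': "continuous_on K f'" and contg': "continuous_on K g'"
    using f(2) g(2) K(2) continuous_on_subset by blast+
  have c1: "continuous_on K (\<lambda>p. f p * (g' p \<bullet> e))"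
    and c2: "continuous_on K (\<lambda>p. (f' p \<bullet> e) * g p)"
    by (intro continuous_intros contf contg contf' contg')+
  then have c: "continuous_on K (\<lambda>p. f p * (g' p \<bullet> e) + (f' p \<bullet> e) * g p)"
    by (rule continuous_on_add)
  note supp = lebesgue_on_integral_compact_support[OF D K]
  show i1: "integrable (lebesgue_on D) (\<lambda>p. f p * (g' p \<bullet> e))"
    by (rule supp(1)[OF c1]) (simp add: g'0)
  show i2: "integrable (lebesgue_on D) (\<lambda>p. (f' p \<bullet> e) * g p)"
    by (rule supp(1)[OF c2]) (simp add: g0)
  \<comment> \<open>\<open>F\<close> is cut off outside \<open>D\<close> and \<open>G\<close>
    already outside \<open>K\<close>. The two are compatible because \<open>g\<close> and
    \<open>g'\<close> both vanish on \<open>D - K\<close>.\<close>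
  define F where "F p = (if p \<in> D then f p * g p else 0)" for p
  define G where "G p = (if p \<in> K then f p *\<^sub>R g' p + g p *\<^sub>R f' p else 0)" for p
  have Ge: "G p \<bullet> e = indicator K p *\<^sub>R (f p * (g' p \<bullet> e) + (f' p \<bullet> e) * g p)" for p
    by (simp add: G_def inner_left_distrib mult.commute)
  have "bounded ((\<lambda>p. f p * (g' p \<bullet> e) + (f' p \<bullet> e) * g p) ` K)"
    using c K(1) compact_continuous_image compact_imp_bounded by blast
  then obtain M where M: "\<And>p. p \<in> K \<Longrightarrow> \<bar>f p * (g' p \<bullet> e) + (f' p \<bullet> e) * g p\<bar> \<le> M"
    by (auto simp: bounded_iff)
  have "(\<integral>p. G p \<bullet> e \<partial>lborel) = 0"
  proof (rule integral_directional_derivative_eq_0[OF _ K(1)])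
    show "(F has_derivative (\<lambda>h. G p \<bullet> h)) (at p)" for p
    proof (cases "p \<in> K")
      case True
      then have "p \<in> D" using K(2) by blast
      have "((\<lambda>p. f p * g p) has_derivative (\<lambda>h. f p * (g' p \<bullet> h) + (f' p \<bullet> h) * g p)) (at p)"
        by (rule has_derivative_mult[OF f(1)[OF \<open>p \<in> D\<close>] g(1)])
      then have "(F has_derivative (\<lambda>h. f p * (g' p \<bullet> h) + (f' p \<bullet> h) * g p)) (at p)"
        by (rule has_derivative_transform_within_open[OF _ D \<open>p \<in> D\<close>]) (simp add: F_def)
      moreover have "(\<lambda>h. f p * (g' p \<bullet> h) + (f' p \<bullet> h) * g p) = (\<lambda>h. G p \<bullet> h)"
        using True by (simp add: G_def inner_left_distrib mult.commute)
      ultimately show ?thesis by simp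
    next
      case False
      then have "G p = 0" by (simp add: G_def)
      then show ?thesis using zero_der[OF False, of F] by (simp add: F_def g0)
    qed
    show "F p = 0" if "p \<notin> K" for p using that g0 by (simp add: F_def)
    show "\<bar>G p \<bullet> e\<bar> \<le> \<bar>M\<bar>" for p
      unfolding Ge using M[of p] by (auto simp: indicator_def)
  qed
  then have "(\<integral>p. f p * (g' p \<bullet> e) + (f' p \<bullet> e) * g p \<partial>lebesgue_on D) = 0"
    by (subst supp(2)[OF c]) (simp_all add: g0 g'0 Ge)
  then show "(\<integral>p. f p * (g' p \<bullet> e) \<partial>lebesgue_on D) = - (\<integral>p. (f' p \<bullet> e) * g p \<partial>lebesgue_on D)"
    using Bochner_Integration.integral_add[OF i1 i2] by simp
qed

subsection \<open>Polynomials in the collapsed coordinates\<close>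

lemma vector_3_axis:
  "(vector [a, b, c] :: real^3) = a *\<^sub>R axis 1 1 + b *\<^sub>R axis 2 1 + c *\<^sub>R axis 3 1"
  by (simp add: vec_eq_iff forall_3 axis_def)

lemma inner_3: "x \<bullet> y = x$1 * y$1 + x$2 * y$2 + x$3 * y$3" for x y :: "real^3"
  by (simp add: inner_vec_def sum_3)

lemma interior_pyramid_bounds:
  assumes "p \<in> interior pyramid"
  shows "p \<in> pyramid" "p$3 < 1"
proof -
  show "p \<in> pyramid" using assms interior_subset by blast
  have "pyramid \<subseteq> {p. p$3 \<le> 1}" by (auto simp: pyramid_def)
  then have "interior pyramid \<subseteq> interior {p. p$3 \<le> 1}" by (rule interior_mono)
  then show "p$3 < 1" using assms by auto
qed

lemma pyramid_minus_apex: "p \<in> pyramid - {apex} \<longleftrightarrow> p \<in> pyramid \<and> p$3 < 1"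
  by (auto simp: pyramid_def apex_def vec_eq_iff forall_3 )

text \<open>The bounds are those of a polynomial in the two ratios and the height. Boundedness of
  \<open>f\<close> itself is part of the definition because the product rule needs it. The gradient
  bound is weak enough to admit the ratios and strong enough for square integrability.\<close>

definition tame :: "(real^3 \<Rightarrow> real) \<Rightarrow> (real^3 \<Rightarrow> real^3) \<Rightarrow> bool" where
  "tame f f' \<longleftrightarrow> continuous_on (interior pyramid) f' \<and>
     (\<exists>M\<ge>0. \<forall>p \<in> interior pyramid. (f has_derivative (\<lambda>h. f' p \<bullet> h)) (at p) \<and>
        \<bar>f p\<bar> \<le> M \<and> norm (f' p) \<le> M / (1 - p$3))"

lemma tame_continuous_on: "tame f f' \<Longrightarrow> continuous_on (interior pyramid) f"
  unfolding tame_def by (meson continuous_at_imp_continuous_on has_derivative_continuous)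

lemma tame_const: "tame (\<lambda>p. c) (\<lambda>p. 0)"
proof -
  have "((\<bullet>) 0) = (\<lambda>h::real^3. 0::real)" by auto
  then show ?thesis
    unfolding tame_def
    by (auto intro!: exI[of _ "\<bar>c\<bar>"] dest: interior_pyramid_bounds)
qed

lemma tame_add:
  assumes "tame f f'" "tame g g'"
  shows "tame (\<lambda>p. f p + g p) (\<lambda>p. f' p + g' p)"
proof -
  obtain M N where M: "M \<ge> 0" "\<forall>p \<in> interior pyramid. (f has_derivative (\<lambda>h. f' p \<bullet> h)) (at p) \<and>
        \<bar>f p\<bar> \<le> M \<and> norm (f' p) \<le> M / (1 - p$3)"
    and N: "N \<ge> 0" "\<forall>p \<in> interior pyramid. (g has_derivative (\<lambda>h. g' p \<bullet> h)) (at p) \<and>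
        \<bar>g p\<bar> \<le> N \<and> norm (g' p) \<le> N / (1 - p$3)"
    using assms unfolding tame_def by blast
  show ?thesis unfolding tame_def
  proof (intro conjI exI[of _ "M + N"] ballI)
    show "continuous_on (interior pyramid) (\<lambda>p. f' p + g' p)"
      using assms unfolding tame_def by (auto intro: continuous_on_add)
    show "0 \<le> M + N" using M N by simp
    fix p assume p: "p \<in> interior pyramid"
    then show "((\<lambda>p. f p + g p) has_derivative (\<lambda>h. (f' p + g' p) \<bullet> h)) (at p)"
      unfolding inner_left_distrib using M N by (intro has_derivative_add) auto
    show "\<bar>f p + g p\<bar> \<le> M + N" using M N p by (meson abs_triangle_ineq add_mono order_trans)
    have "norm (f' p + g' p) \<le> M / (1 - p$3) + N / (1 - p$3)"
      using M N p by (meson norm_triangle_le add_mono)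
    then show "norm (f' p + g' p) \<le> (M + N) / (1 - p$3)" by (simp add: add_divide_distrib)
  qed
qed

lemma tame_mult:
  assumes "tame f f'" "tame g g'"
  shows "tame (\<lambda>p. f p * g p) (\<lambda>p. f p *\<^sub>R g' p + g p *\<^sub>R f' p)"
proof -
  obtain M N where M: "M \<ge> 0" "\<forall>p \<in> interior pyramid. (f has_derivative (\<lambda>h. f' p \<bullet> h)) (at p) \<and>
        \<bar>f p\<bar> \<le> M \<and> norm (f' p) \<le> M / (1 - p$3)"
    and N: "N \<ge> 0" "\<forall>p \<in> interior pyramid. (g has_derivative (\<lambda>h. g' p \<bullet> h)) (at p) \<and>
        \<bar>g p\<bar> \<le> N \<and> norm (g' p) \<le> N / (1 - p$3)"
    using assms unfolding tame_def by blast
  show ?thesis unfolding tame_def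
  proof (intro conjI exI[of _ "2 * (M * N)"] ballI)
    show "continuous_on (interior pyramid) (\<lambda>p. f p *\<^sub>R g' p + g p *\<^sub>R f' p)"
      using assms tame_continuous_on[OF assms(1)] tame_continuous_on[OF assms(2)] unfolding tame_def
      by (auto intro!: continuous_intros)
    show "0 \<le> 2 * (M * N)" using M N by simp
    fix p assume p: "p \<in> interior pyramid"
    have "((\<lambda>p. f p * g p) has_derivative (\<lambda>h. f p * (g' p \<bullet> h) + (f' p \<bullet> h) * g p)) (at p)"
      using M N p by (intro has_derivative_mult) auto
    then show "((\<lambda>p. f p * g p) has_derivative (\<lambda>h. (f p *\<^sub>R g' p + g p *\<^sub>R f' p) \<bullet> h)) (at p)"
      by (simp add: inner_left_distrib mult.commute)
    have "\<bar>f p * g p\<bar> \<le> M * N"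
      unfolding abs_mult using M N p by (intro mult_mono) auto
    then show "\<bar>f p * g p\<bar> \<le> 2 * (M * N)" using M(1) N(1) mult_nonneg_nonneg[of M N] by linarith
    have "norm (f p *\<^sub>R g' p + g p *\<^sub>R f' p) \<le> \<bar>f p\<bar> * norm (g' p) + \<bar>g p\<bar> * norm (f' p)"
      by (metis norm_scaleR norm_triangle_ineq)
    also have "\<dots> \<le> M * (N / (1 - p$3)) + N * (M / (1 - p$3))"
      using M N p by (intro add_mono mult_mono) auto
    finally show "norm (f p *\<^sub>R g' p + g p *\<^sub>R f' p) \<le> 2 * (M * N) / (1 - p$3)"
      by (simp add: mult.commute)
  qed
qed

text \<open>Hides the gradient, so that the closure rules compose without spelling out the
  derivative of a large sum.\<close>

definition tameable :: "(real^3 \<Rightarrow> real) \<Rightarrow> bool" where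
  "tameable f \<longleftrightarrow> (\<exists>f'. tame f f')"

lemma tameable_const: "tameable (\<lambda>p. c)"
  unfolding tameable_def using tame_const by blast

lemma tameable_add: "tameable f \<Longrightarrow> tameable g \<Longrightarrow> tameable (\<lambda>p. f p + g p)"
  unfolding tameable_def using tame_add by blast

lemma tameable_mult: "tameable f \<Longrightarrow> tameable g \<Longrightarrow> tameable (\<lambda>p. f p * g p)"
  unfolding tameable_def using tame_mult by blast

lemma tameable_power: "tameable f \<Longrightarrow> tameable (\<lambda>p. f p ^ n)"
  by (induction n) (auto intro: tameable_const tameable_mult)

lemma tameable_sum: "(\<And>i. i \<in> I \<Longrightarrow> tameable (f i)) \<Longrightarrow> tameable (\<lambda>p. \<Sum>i\<in>I. f i p)"
  by (induction I rule: infinite_finite_induct) (auto intro: tameable_const tameable_add)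

lemma tameable_coord3: "tameable (\<lambda>p. p$3)"
  unfolding tameable_def tame_def
proof (intro exI[of _ "\<lambda>p. axis 3 1"] conjI exI[of _ 1] ballI)
  fix p :: "real^3" assume "p \<in> interior pyramid"
  then have b: "0 \<le> p$3" "p$3 < 1" using interior_pyramid_bounds[of p] by (auto simp: pyramid_def)
  show "((\<lambda>p. p$3) has_derivative (\<lambda>h. axis 3 1 \<bullet> h)) (at p)"
    by (simp add: inner_3 axis_def) (rule bounded_linear_imp_has_derivative, simp add: bounded_linear_vec_nth)
  show "\<bar>p$3\<bar> \<le> 1" using b by simp
  show "norm (axis 3 (1::real) :: real^3) \<le> 1 / (1 - p$3)" using b by (simp add: norm_axis_1 field_simps)
qed auto

text \<open>The gradient has the terms \<open>1 / (1 - p$3)\<close> and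
  \<open>p$i / (1 - p$3)^2\<close>. On the pyramid \<open>p$i \<le> 1 - p$3\<close>, so the second
  is no larger than the first. Together they give the constant 2.\<close>

lemma tameable_ratio:
  assumes "i = 1 \<or> i = 2"
  shows "tameable (\<lambda>p. p$i / (1 - p$3))"
  unfolding tameable_def tame_def
proof (intro exI[of _ "\<lambda>p. (1 / (1 - p$3)) *\<^sub>R axis i 1 + (p$i / (1 - p$3)^2) *\<^sub>R axis 3 1"] conjI exI[of _ 2] ballI)
  show "continuous_on (interior pyramid) (\<lambda>p::real^3. (1 / (1 - p$3)) *\<^sub>R axis i (1::real) + (p$i / (1 - p$3)^2) *\<^sub>R axis 3 1 :: real^3)"
    by (auto intro!: continuous_intros dest: interior_pyramid_bounds)
  fix p :: "real^3" assume "p \<in> interior pyramid"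
  then have b: "0 \<le> p$3" "p$3 < 1" "0 \<le> p$i" "p$i \<le> 1 - p$3"
    using interior_pyramid_bounds[of p] assms by (auto simp: pyramid_def)
  have nth: "((\<lambda>p. p$j) has_derivative (\<lambda>h. h$j)) (at p)" for j :: 3
    by (rule bounded_linear_imp_has_derivative, simp add: bounded_linear_vec_nth)
  have "((\<lambda>p. p$i / (1 - p$3)) has_derivative
      (\<lambda>h. (h$i * (1 - p$3) - p$i * (0 - h$3)) / ((1 - p$3) * (1 - p$3)))) (at p)"
    using b by (intro has_derivative_divide' has_derivative_diff has_derivative_const nth) auto
  moreover have "1 / d * a + x / d^2 * b = (a * d - x * (0 - b)) / (d * d)" if "d \<noteq> 0" for a b x d :: real
    using that by (simp add: field_simps power2_eq_square)
  ultimately show "((\<lambda>p. p$i / (1 - p$3)) has_derivative (\<lambda>h. ((1 / (1 - p$3)) *\<^sub>R axis i 1 + (p$i / (1 - p$3)^2) *\<^sub>R axis 3 1) \<bullet> h)) (at p)"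
    using b by (simp add: inner_left_distrib inner_axis')
  show "\<bar>p$i / (1 - p$3)\<bar> \<le> 2" using b by (simp add: field_simps)
  have bound: "\<bar>1 / d\<bar> * 1 + \<bar>x / d^2\<bar> * 1 \<le> 2 / d" if "0 < d" "0 \<le> x" "x \<le> d" for d x :: real
    using that by (simp add: field_simps power2_eq_square)
  have "norm ((1 / (1 - p$3)) *\<^sub>R axis i (1::real) + (p$i / (1 - p$3)^2) *\<^sub>R axis 3 1 :: real^3)
     \<le> \<bar>1 / (1 - p$3)\<bar> * 1 + \<bar>p$i / (1 - p$3)^2\<bar> * 1"
    by (rule norm_triangle_le) (simp add: norm_axis_1)
  also have "\<dots> \<le> 2 / (1 - p$3)" using b by (intro bound) auto
  finally show "norm ((1 / (1 - p$3)) *\<^sub>R axis i (1::real) + (p$i / (1 - p$3)^2) *\<^sub>R axis 3 1 :: real^3) \<le> 2 / (1 - p$3)" .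
qed auto

lemma tameable_Q2:
  assumes "f \<in> Q2 l m"
  shows "tameable (\<lambda>p. f (p$1 / (1 - p$3)) (p$2 / (1 - p$3)))"
proof -
  obtain c where f: "f = (\<lambda>x y. \<Sum>i<nat (l + 1). \<Sum>j<nat (m + 1). c i j * x^i * y^j)"
    using assms unfolding Q2_def by blast
  show ?thesis unfolding f
    by (intro tameable_sum tameable_mult tameable_const tameable_power tameable_ratio) auto
qed

section \<open>Square integrability near the apex\<close>

lemma prod_UNIV_3: "prod f (UNIV :: 3 set) = f 1 * (f 2 * f 3)"
  unfolding UNIV_3 by simp

text \<open>Dyadic layers towards the apex: where the distance \<open>1 - p$3\<close> lies between
  \<open>(1/2)^(n+1)\<close> and \<open>(1/2)^n\<close>, the integrand is at most
  \<open>4^(n+1)\<close> and the point lies in a cube \<open>B n\<close> of volume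
  \<open>(1/8)^n\<close>. The products form a convergent geometric series of ratio 1/2.\<close>

lemma nn_integral_inverse_square_height:
  "(\<integral>\<^sup>+p. ennreal (1 / (1 - p$3)^2) * indicator (interior pyramid) p \<partial>lborel) < \<infinity>"
proof -
  define B :: "nat \<Rightarrow> (real^3) set" where
    "B n = cbox (vector [0, 0, 1 - (1/2)^n]) (vector [(1/2)^n, (1/2)^n, 1])" for n
  have sets_B: "B n \<in> sets lborel" for n by (simp add: B_def)
  have emB: "emeasure lborel (B n) = ennreal ((1/8)^n)" for n
  proof -
    let ?a = "vector [0, 0, 1 - (1/2)^n] :: real^3" and ?b = "vector [(1/2)^n, (1/2)^n, 1] :: real^3"
    have "emeasure lborel (B n) = ennreal (measure lborel (cbox ?a ?b))"
      unfolding B_def using emeasure_lborel_cbox_finite[of ?a ?b]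
      by (simp add: emeasure_eq_ennreal_measure less_top)
    also have "measure lborel (cbox ?a ?b) = (\<Prod>i\<in>UNIV. ?b$i - ?a$i)"
    proof (rule content_cbox_cart)
      have "?b \<in> cbox ?a ?b" by (simp add: mem_box_cart forall_3)
      then show "cbox ?a ?b \<noteq> {}" by blast
    qed
    also have "\<dots> = (?b$1 - ?a$1) * ((?b$2 - ?a$2) * (?b$3 - ?a$3))"
      by (rule prod_UNIV_3)
    also have "\<dots> = (1/2)^n * ((1/2)^n * (1/2)^n)"
      by (simp only: vector_3 diff_zero diff_diff_eq2 add_diff_cancel_left')
    also have "\<dots> = (1/8)^n" by (simp only: power_mult_distrib[symmetric]) simp
    finally show ?thesis .
  qed
  have ennreal_term_le: "F n \<le> suminf F" for F :: "nat \<Rightarrow> ennreal" and n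
    using sum_le_suminf[OF summableI, of "{n}" F] by simp
  have le: "ennreal (1 / (1 - p$3)^2) * indicator (interior pyramid) p
      \<le> (\<Sum>n. ennreal (4^Suc n) * indicator (B n) p)" for p
  proof (cases "p \<in> interior pyramid")
    case True
    then have b: "0 \<le> p$1" "0 \<le> p$2" "0 \<le> p$3" "p$3 < 1" "p$1 \<le> 1 - p$3" "p$2 \<le> 1 - p$3"
      using interior_pyramid_bounds[of p] by (auto simp: pyramid_def)
    define d where "d = 1 - p$3"
    have d: "0 < d" "d \<le> 1" using b by (auto simp: d_def)
    obtain n0 where n0: "(1/2)^n0 < d" using real_arch_pow_inv[of d "1/2"] d by auto
    \<comment> \<open>The least exponent with \<open>(1/2)^m < d\<close> is positive because
      \<open>d \<le> 1\<close>. Its predecessor \<open>n\<close> is the index of the layer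
      containing the point.\<close>
    define m where "m = (LEAST n. (1/2)^n < d)"
    have m: "(1/2)^m < d" unfolding m_def by (rule LeastI) (rule n0)
    then have "m \<noteq> 0" using d by (metis not_le power_0)
    then obtain n where n: "m = Suc n" using not0_implies_Suc by blast
    have "n < (LEAST n. (1/2)^n < d)" using n by (simp only: m_def[symmetric])
    then have "\<not> (1/2)^n < d" by (rule not_less_Least)
    then have dn: "d \<le> (1/2)^n" by simp
    have "((1/2)^Suc n)^2 \<le> d^2" using m n by (intro power_mono) auto
    then have "1 / d^2 \<le> 1 / ((1/2)^Suc n)^2" using d by (intro divide_left_mono) auto
    also have "((1/2::real)^Suc n)^2 = ((1/2)^2)^Suc n"
      by (simp only: power_mult[symmetric] mult.commute)
    also have "1 / ((1/2::real)^2)^Suc n = 4^Suc n" by (simp add: power_divide)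
    finally have "1 / d^2 \<le> 4^Suc n" .
    moreover have "p \<in> B n" using b dn by (auto simp: B_def mem_box_cart forall_3 d_def)
    ultimately have "ennreal (1 / (1 - p$3)^2) * indicator (interior pyramid) p
       \<le> ennreal (4^Suc n) * indicator (B n) p"
      using True ennreal_leI[of "1 / d^2" "4^Suc n"] by (simp only: d_def indicator_simps mult_1_right)
    also have "\<dots> \<le> (\<Sum>n. ennreal (4^Suc n) * indicator (B n) p)"
      by (rule ennreal_term_le)
    finally show ?thesis .
  qed auto
  have "(\<integral>\<^sup>+p. ennreal (1 / (1 - p$3)^2) * indicator (interior pyramid) p \<partial>lborel)
      \<le> (\<integral>\<^sup>+p. (\<Sum>n. ennreal (4^Suc n) * indicator (B n) p) \<partial>lborel)"
    by (intro nn_integral_mono le)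
  also have "\<dots> = (\<Sum>n. \<integral>\<^sup>+p. ennreal (4^Suc n) * indicator (B n) p \<partial>lborel)"
    by (rule nn_integral_suminf) (auto simp: B_def)
  also have "\<dots> = (\<Sum>n. ennreal (4 * (1/2)^n))"
  proof (intro arg_cong[of _ _ suminf] ext)
    fix n
    have "(\<integral>\<^sup>+p. ennreal (4^Suc n) * indicator (B n) p \<partial>lborel) = ennreal (4^Suc n) * ennreal ((1/8)^n)"
      using nn_integral_cmult_indicator[of "B n" lborel "ennreal (4^Suc n)"]
      by (simp only: emB sets_B)
    also have "\<dots> = ennreal (4^Suc n * (1/8)^n)" by (rule ennreal_mult[symmetric]) auto
    also have "(4::real)^Suc n * (1/8)^n = 4 * (4 * (1/8))^n"
      by (simp only: power_Suc mult.assoc power_mult_distrib)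
    also have "\<dots> = 4 * (1/2)^n" by simp
    finally show "(\<integral>\<^sup>+p. ennreal (4^Suc n) * indicator (B n) p \<partial>lborel) = ennreal (4 * (1/2)^n)" .
  qed
  also have "\<dots> < \<infinity>"
    by (subst suminf_ennreal2[OF _ summable_mult[OF summable_geometric]]) auto
  finally show ?thesis .
qed

lemma L2_fields_interior_pyramid:
  assumes f: "continuous_on (interior pyramid) f"
    and M: "\<And>p. p \<in> interior pyramid \<Longrightarrow> norm (f p) \<le> M / (1 - p$3)"
    and v: "\<And>p. p \<in> interior pyramid \<Longrightarrow> v p = f p"
  shows "v \<in> L2_fields (interior pyramid)"
proof -
  let ?D = "interior pyramid"
  have D: "?D \<in> sets lebesgue" by simp
  have meas: "h \<in> borel_measurable (lebesgue_on ?D)" if "continuous_on ?D h"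
    for h :: "real^3 \<Rightarrow> 'b::euclidean_space"
    by (rule continuous_imp_measurable_on_sets_lebesgue[OF that D])
  have "f \<in> borel_measurable (lebesgue_on ?D)" using meas f by blast
  then have mv[measurable]: "v \<in> borel_measurable (lebesgue_on ?D)"
    by (subst measurable_cong[of _ _ f]) (auto simp: v)
  have ch: "continuous_on ?D (\<lambda>p. 1 / (1 - p$3)^2)"
    by (auto intro!: continuous_intros dest: interior_pyramid_bounds)
  have "(\<integral>\<^sup>+p. ennreal (1 / (1 - p$3)^2) \<partial>lebesgue_on ?D) < \<infinity>"
    using nn_integral_inverse_square_height
    by (subst nn_integral_restrict_space) (auto simp: nn_integral_completion)
  then have ih: "integrable (lebesgue_on ?D) (\<lambda>p. 1 / (1 - p$3)^2)"
    by (intro integrableI_nonneg meas ch) auto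
  have "integrable (lebesgue_on ?D) (\<lambda>p. (norm (v p))\<^sup>2)"
  proof (rule Bochner_Integration.integrable_bound[OF integrable_mult_right[OF ih, of "M^2"]])
    show "(\<lambda>p. (norm (v p))\<^sup>2) \<in> borel_measurable (lebesgue_on ?D)" by measurable
    have "(norm (v p))^2 \<le> (M / (1 - p$3))^2" if "p \<in> ?D" for p
      using M[OF that] v[OF that] by (intro power_mono) auto
    then show "AE p in lebesgue_on ?D. norm ((norm (v p))\<^sup>2) \<le> norm (M\<^sup>2 * (1 / (1 - p$3)\<^sup>2))"
      by (intro AE_I2) (auto simp: power_divide)
  qed
  then show ?thesis using mv by (simp add: L2_fields_def)
qed

section \<open>The weak curl of a field with tame components\<close>

lemma has_derivative_partial:
  fixes f :: "real^3 \<Rightarrow> real^3"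
  assumes "f differentiable (at p)"
  shows "((\<lambda>p. f p $ l) has_derivative (\<lambda>h. (\<chi> i. partial i f p $ l) \<bullet> h)) (at p)"
proof -
  let ?D = "frechet_derivative f (at p)"
  have D: "(f has_derivative ?D) (at p)" using assms by (simp add: frechet_derivative_works)
  then have lin: "linear ?D" by (rule has_derivative_linear)
  have "?D h $ l = (\<chi> i. partial i f p $ l) \<bullet> h" for h
  proof -
    have "h = h$1 *\<^sub>R axis 1 1 + h$2 *\<^sub>R axis 2 1 + h$3 *\<^sub>R axis 3 1"
      by (simp add: vec_eq_iff forall_3 axis_def)
    then have "?D h = ?D (h$1 *\<^sub>R axis 1 1 + h$2 *\<^sub>R axis 2 1 + h$3 *\<^sub>R axis 3 1)" by simp
    also have "\<dots> = h$1 *\<^sub>R partial 1 f p + h$2 *\<^sub>R partial 2 f p + h$3 *\<^sub>R partial 3 f p"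
      by (simp add: linear_add[OF lin] linear_cmul[OF lin] partial_def)
    finally show ?thesis by (simp add: inner_3 mult.commute)
  qed
  moreover have "((\<lambda>p. f p $ l) has_derivative (\<lambda>h. ?D h $ l)) (at p)"
    using bounded_linear.has_derivative[OF bounded_linear_vec_nth D] .
  ultimately show ?thesis by simp
qed

lemma tame_norm_bound:
  assumes "tame f f'"
  obtains M where "M \<ge> 0" "\<And>p. p \<in> interior pyramid \<Longrightarrow> \<bar>f p\<bar> \<le> M / (1 - p$3)"
    "\<And>p i. p \<in> interior pyramid \<Longrightarrow> \<bar>f' p $ i\<bar> \<le> M / (1 - p$3)"
proof -
  obtain M where M: "M \<ge> 0" "\<forall>p \<in> interior pyramid. \<bar>f p\<bar> \<le> M \<and> norm (f' p) \<le> M / (1 - p$3)"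
    using assms unfolding tame_def by blast
  have "\<bar>f p\<bar> \<le> M / (1 - p$3)" if p: "p \<in> interior pyramid" for p
  proof -
    have "0 < 1 - p$3" "1 - p$3 \<le> 1"
      using interior_pyramid_bounds[OF p] by (auto simp: pyramid_def)
    then have "M / 1 \<le> M / (1 - p$3)" using M(1) by (intro divide_left_mono) auto
    moreover have "\<bar>f p\<bar> \<le> M" using M(2) p by blast
    ultimately show ?thesis by linarith
  qed
  moreover have "\<bar>f' p $ i\<bar> \<le> M / (1 - p$3)" if "p \<in> interior pyramid" for p i
    using M(2) that component_le_norm_cart order_trans by blast
  ultimately show thesis using that M(1) by blast
qed

lemma continuous_on_vector_3:
  assumes "continuous_on S a" "continuous_on S b" "continuous_on S c"
  shows "continuous_on S (\<lambda>p. vector [a p, b p, c p] :: real^3)"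
  unfolding vector_3_axis using assms by (intro continuous_intros)

lemma norm_vector_3_le: "norm (vector [a, b, c] :: real^3) \<le> \<bar>a\<bar> + \<bar>b\<bar> + \<bar>c\<bar>"
  using norm_le_l1_cart[of "vector [a, b, c] :: real^3"] by (simp add: sum_3)

text \<open>The candidate for the weak curl is the classical one. Its entries are differences of
  first derivatives, hence of order \<open>1 / (1 - p$3)\<close> and square integrable. Test fields
  are supported in a compact subset of the interior, so neither the faces nor the apex contribute
  when the six terms are integrated by parts one at a time.\<close>

lemma Hcurl_tame:
  assumes t1: "tame f1 f1'" and t2: "tame f2 f2'" and t3: "tame f3 f3'"
    and v: "\<And>p. p \<in> interior pyramid \<Longrightarrow> v p = vector [f1 p, f2 p, f3 p]"
  shows "v \<in> Hcurl (interior pyramid)"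
proof -
  let ?D = "interior pyramid"
  obtain M1 where "M1 \<ge> 0" and M1: "\<And>p. p \<in> ?D \<Longrightarrow> \<bar>f1 p\<bar> \<le> M1 / (1 - p$3)"
    "\<And>p i. p \<in> ?D \<Longrightarrow> \<bar>f1' p $ i\<bar> \<le> M1 / (1 - p$3)" 
    by (rule tame_norm_bound[OF t1]) (rule that)
  obtain M2 where "M2 \<ge> 0" and M2: "\<And>p. p \<in> ?D \<Longrightarrow> \<bar>f2 p\<bar> \<le> M2 / (1 - p$3)"
    "\<And>p i. p \<in> ?D \<Longrightarrow> \<bar>f2' p $ i\<bar> \<le> M2 / (1 - p$3)" 
    by (rule tame_norm_bound[OF t2]) (rule that)
  obtain M3 where "M3 \<ge> 0" and M3: "\<And>p. p \<in> ?D \<Longrightarrow> \<bar>f3 p\<bar> \<le> M3 / (1 - p$3)"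
    "\<And>p i. p \<in> ?D \<Longrightarrow> \<bar>f3' p $ i\<bar> \<le> M3 / (1 - p$3)" 
    by (rule tame_norm_bound[OF t3]) (rule that)
  have c: "continuous_on ?D f1" "continuous_on ?D f2" "continuous_on ?D f3"
    using t1 t2 t3 by (auto intro: tame_continuous_on)
  have c': "continuous_on ?D f1'" "continuous_on ?D f2'" "continuous_on ?D f3'"
    using t1 t2 t3 by (auto simp: tame_def)
  have der: "\<And>p. p \<in> ?D \<Longrightarrow> (f1 has_derivative (\<lambda>h. f1' p \<bullet> h)) (at p)"
    "\<And>p. p \<in> ?D \<Longrightarrow> (f2 has_derivative (\<lambda>h. f2' p \<bullet> h)) (at p)"
    "\<And>p. p \<in> ?D \<Longrightarrow> (f3 has_derivative (\<lambda>h. f3' p \<bullet> h)) (at p)"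
    using t1 t2 t3 by (auto simp: tame_def)
  have vL2: "v \<in> L2_fields ?D"
  proof (rule L2_fields_interior_pyramid[OF _ _ v])
    show "continuous_on ?D (\<lambda>p. vector [f1 p, f2 p, f3 p] :: real^3)"
      by (rule continuous_on_vector_3[OF c])
    show "norm (vector [f1 p, f2 p, f3 p] :: real^3) \<le> (M1 + M2 + M3) / (1 - p$3)" if "p \<in> ?D" for p
      using norm_vector_3_le[of "f1 p" "f2 p" "f3 p"] M1(1)[OF that] M2(1)[OF that] M3(1)[OF that]
      by (simp add: add_divide_distrib)
  qed
  define g :: "real^3 \<Rightarrow> real^3" where
    "g p = vector [f3' p $ 2 - f2' p $ 3, f1' p $ 3 - f3' p $ 1, f2' p $ 1 - f1' p $ 2]" for p
  have gL2: "g \<in> L2_fields ?D"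
  proof (rule L2_fields_interior_pyramid)
    show "continuous_on ?D g"
      unfolding g_def by (intro continuous_on_vector_3 continuous_intros c')
    show "norm (g p) \<le> (2 * (M1 + M2 + M3)) / (1 - p$3)" if "p \<in> ?D" for p
    proof -
      have "norm (g p) \<le> (\<bar>f3' p $ 2\<bar> + \<bar>f2' p $ 3\<bar>) + (\<bar>f1' p $ 3\<bar> + \<bar>f3' p $ 1\<bar>) + (\<bar>f2' p $ 1\<bar> + \<bar>f1' p $ 2\<bar>)"
        unfolding g_def by (rule order_trans[OF norm_vector_3_le]) (intro add_mono abs_triangle_ineq4)
      also have "\<dots> \<le> (M3 / (1 - p$3) + M2 / (1 - p$3)) + (M1 / (1 - p$3) + M3 / (1 - p$3)) + (M2 / (1 - p$3) + M1 / (1 - p$3))"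
        by (intro add_mono M1 M2 M3 that)
      also have "\<dots> = (2 * (M1 + M2 + M3)) / (1 - p$3)" by (simp add: add_divide_distrib)
      finally show ?thesis .
    qed
  qed auto
  have "(\<integral>p. v p \<bullet> curl \<psi> p \<partial>lebesgue_on ?D) = (\<integral>p. g p \<bullet> \<psi> p \<partial>lebesgue_on ?D)"
    if psi: "\<psi> \<in> test_fields ?D" for \<psi>
  proof -
    let ?K = "closure {p. \<psi> p \<noteq> 0}"
    have psi': "(\<forall>n. Ck n \<psi>) \<and> compact ?K \<and> ?K \<subseteq> ?D"
      using psi unfolding test_fields_def mem_Collect_eq .
    note K = psi'[THEN conjunct2, THEN conjunct1] psi'[THEN conjunct2, THEN conjunct2]
    have "Ck (Suc 0) \<psi>" by (rule psi'[THEN conjunct1, THEN spec])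
    then have diff: "\<psi> differentiable (at p)" and cont: "continuous_on UNIV (partial i \<psi>)" for p i
      by (auto simp: differentiable_on_def)
    have psi0: "\<psi> p $ l = 0" if "p \<notin> ?K" for p l
    proof -
      have "p \<notin> {p. \<psi> p \<noteq> 0}" using that by (meson closure_subset subsetD)
      then show ?thesis by simp
    qed
    let ?G = "\<lambda>l p. (\<chi> i. partial i \<psi> p $ l) :: real^3"
    have derpsi: "((\<lambda>p. \<psi> p $ l) has_derivative (\<lambda>h. ?G l p \<bullet> h)) (at p)" for p l
      by (rule has_derivative_partial[OF diff])
    have contG: "continuous_on UNIV (?G l)" for l
      by (rule continuous_on_vec_lambda, rule continuous_on_component, rule cont)
    have axis: "x \<bullet> axis i 1 = x $ i" for i and x :: "real^3" by (simp add: inner_axis)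
    have parts: "integrable (lebesgue_on ?D) (\<lambda>p. f p * (partial i \<psi> p $ l))"
        "integrable (lebesgue_on ?D) (\<lambda>p. (f' p $ i) * (\<psi> p $ l))"
        "(\<integral>p. f p * (partial i \<psi> p $ l) \<partial>lebesgue_on ?D) = - (\<integral>p. (f' p $ i) * (\<psi> p $ l) \<partial>lebesgue_on ?D)"
      if "\<And>p. p \<in> ?D \<Longrightarrow> (f has_derivative (\<lambda>h. f' p \<bullet> h)) (at p)" "continuous_on ?D f'"
      for f f' l i
      using integration_by_parts_compact_support[OF open_interior K psi0[where l = l] that derpsi contG, where e = "axis i 1"]
      by (simp_all only: axis vec_lambda_beta not_False_eq_True implies_True_equals True_implies_equals triv_forall_equality)
    note parts1 = parts[OF der(1) c'(1)] and parts2 = parts[OF der(2) c'(2)] and parts3 = parts[OF der(3) c'(3)]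
    have "(\<integral>p. v p \<bullet> curl \<psi> p \<partial>lebesgue_on ?D) =
      (\<integral>p. (f1 p * (partial 2 \<psi> p $ 3) - f1 p * (partial 3 \<psi> p $ 2))
         + (f2 p * (partial 3 \<psi> p $ 1) - f2 p * (partial 1 \<psi> p $ 3))
         + (f3 p * (partial 1 \<psi> p $ 2) - f3 p * (partial 2 \<psi> p $ 1)) \<partial>lebesgue_on ?D)"
      by (rule Bochner_Integration.integral_cong[OF refl]) (simp add: v curl_def inner_3 algebra_simps)
    also have "\<dots> = (\<integral>p. (f3' p $ 2 * (\<psi> p $ 1) - f2' p $ 3 * (\<psi> p $ 1))
         + (f1' p $ 3 * (\<psi> p $ 2) - f3' p $ 1 * (\<psi> p $ 2))
         + (f2' p $ 1 * (\<psi> p $ 3) - f1' p $ 2 * (\<psi> p $ 3)) \<partial>lebesgue_on ?D)"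
      by (simp add: parts1 parts2 parts3 Bochner_Integration.integral_add Bochner_Integration.integral_diff Bochner_Integration.integrable_add Bochner_Integration.integrable_diff)
    also have "\<dots> = (\<integral>p. g p \<bullet> \<psi> p \<partial>lebesgue_on ?D)"
      by (rule Bochner_Integration.integral_cong[OF refl]) (simp add: g_def inner_3 algebra_simps)
    finally show ?thesis .
  qed
  then show ?thesis using vL2 gL2 unfolding Hcurl_def by blast
qed

subsection \<open>Pullbacks to the infinite pyramid\<close>

lemma pullback1_nth: "pullback1 f E p $ i = frechet_derivative f (at p) (axis i 1) \<bullet> E (f p)"
  by (simp add: pullback1_def jacobian_def matrix_def matrix_vector_mult_def transpose_def inner_vec_def)

lemma phi_eq_scaleR: "phi p = inverse (1 + p$3) *\<^sub>R p"
  by (simp add: phi_def vec_eq_iff forall_3 field_simps)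

lemma phi_has_derivative:
  assumes "p$3 \<noteq> -1"
  shows "(phi has_derivative (\<lambda>h. inverse (1 + p$3) *\<^sub>R h - (h$3 / (1 + p$3)^2) *\<^sub>R p)) (at p)"
proof -
  have "((\<lambda>p::real^3. p$3) has_derivative (\<lambda>h. h$3)) (at p)"
    by (rule bounded_linear_imp_has_derivative, simp add: bounded_linear_vec_nth)
  then show ?thesis
    unfolding phi_eq_scaleR[abs_def] using assms
    by (auto intro!: derivative_eq_intros simp: fun_eq_iff power2_eq_square field_simps)
qed

text \<open>The first two columns of the Jacobian are \<open>axis i 1\<close> divided by
  \<open>1 + p$3\<close>. In the third column the vertical entry is \<open>(1 + z) - z\<close> over
  \<open>(1 + z)^2\<close>, so the column is \<open>(-x, -y, 1)\<close> over
  \<open>(1 + z)^2\<close>.\<close>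

lemma pullback1_phi:
  assumes "p$3 \<ge> 0"
  shows "pullback1 phi E p $ 1 = E (phi p) $ 1 / (1 + p$3)"
    "pullback1 phi E p $ 2 = E (phi p) $ 2 / (1 + p$3)"
    "pullback1 phi E p $ 3 = (E (phi p) $ 3 - p$1 * E (phi p) $ 1 - p$2 * E (phi p) $ 2) / (1 + p$3)^2"
proof -
  have p: "p$3 \<noteq> -1" using assms by simp
  have fd: "frechet_derivative phi (at p) = (\<lambda>h. inverse (1 + p$3) *\<^sub>R h - (h$3 / (1 + p$3)^2) *\<^sub>R p)"
    by (rule frechet_derivative_at[symmetric, OF phi_has_derivative[OF p]])
  show "pullback1 phi E p $ 1 = E (phi p) $ 1 / (1 + p$3)"
    "pullback1 phi E p $ 2 = E (phi p) $ 2 / (1 + p$3)"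
    by (simp_all add: pullback1_nth fd axis_def inner_3 divide_inverse mult.commute)
  have "a / c - (x * b + y * d + z * a) / c^2 = (a - x * b - y * d) / c^2" if "c = 1 + z" "c \<noteq> 0" for a b c d x y z :: real
  proof -
    have "a / c = (a * c) / c^2" using that by (simp add: power2_eq_square)
    then have "a / c - (x * b + y * d + z * a) / c^2 = (a * c - (x * b + y * d + z * a)) / c^2"
      by (simp only: diff_divide_distrib)
    also have "a * c - (x * b + y * d + z * a) = a - x * b - y * d"
      unfolding that(1) by (simp add: algebra_simps)
    finally show ?thesis .
  qed
  from this[of "1 + p$3" "p$3" "E (phi p) $ 3" "p$1" "E (phi p) $ 1" "p$2" "E (phi p) $ 2"]
  show "pullback1 phi E p $ 3 = (E (phi p) $ 3 - p$1 * E (phi p) $ 1 - p$2 * E (phi p) $ 2) / (1 + p$3)^2"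
    using assms by (simp add: pullback1_nth fd axis_def inner_3 divide_inverse algebra_simps)
qed

lemma phi_in_pyramid:
  assumes "p \<in> pyramid_inf"
  shows "phi p \<in> pyramid - {apex}"
proof -
  have p: "0 \<le> p$1" "p$1 \<le> 1" "0 \<le> p$2" "p$2 \<le> 1" "0 \<le> p$3"
    using assms by (auto simp: pyramid_inf_def)
  then have "1 - p$3 / (1 + p$3) = 1 / (1 + p$3)" by (simp add: field_simps)
  then show ?thesis
    unfolding pyramid_minus_apex using p by (auto simp: pyramid_def phi_def divide_right_mono)
qed

definition phi_inv :: "real^3 \<Rightarrow> real^3" where
  "phi_inv p = vector [p$1 / (1 - p$3), p$2 / (1 - p$3), p$3 / (1 - p$3)]"

lemma phi_inv:
  assumes "p \<in> pyramid - {apex}"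
  shows "phi_inv p \<in> pyramid_inf" "phi (phi_inv p) = p"
proof -
  have p: "p \<in> pyramid" "p$3 < 1" using assms unfolding pyramid_minus_apex by auto
  then show "phi_inv p \<in> pyramid_inf"
    by (auto simp: pyramid_def pyramid_inf_def phi_inv_def field_simps)
  have "1 + p$3 / (1 - p$3) = 1 / (1 - p$3)" using p by (simp add: field_simps)
  then show "phi (phi_inv p) = p"
    using p by (simp add: phi_inv_def phi_def vec_eq_iff forall_3)
qed

text \<open>\<open>phi\<close> maps the faces of the infinite pyramid into those of the finite one,
  and the pulled back components tangential to a face depend only on the tangential trace
  there.\<close>

lemma zero_tangential_pullback1:
  assumes v: "zero_tangential v" and p: "p \<in> pyramid_inf"
  shows "p$2 = 0 \<or> p$2 = 1 \<Longrightarrow> pullback1 phi v p $ 1 = 0 \<and> pullback1 phi v p $ 3 = 0"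
    "p$1 = 0 \<or> p$1 = 1 \<Longrightarrow> pullback1 phi v p $ 2 = 0 \<and> pullback1 phi v p $ 3 = 0"
    "p$3 = 0 \<Longrightarrow> pullback1 phi v p $ 1 = 0 \<and> pullback1 phi v p $ 2 = 0"
proof -
  have z: "p$3 \<ge> 0" using p by (simp add: pyramid_inf_def)
  have face: "cross3 n (v (phi p)) = 0" if "(n, c) \<in> pyramid_normals" "n \<bullet> phi p = c" for n c
    using v phi_in_pyramid[OF p] that unfolding zero_tangential_def by blast
  note simps = pyramid_normals_def inner_3 phi_def cross3_def vec_eq_iff forall_3
  show "pullback1 phi v p $ 1 = 0 \<and> pullback1 phi v p $ 3 = 0" if "p$2 = 0 \<or> p$2 = 1"
    using that
  proof
    assume "p$2 = 0"
    then show ?thesis using face[of "vector [0, -1, 0]" 0] z by (simp add: simps pullback1_phi)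
  next
    \<comment> \<open>On this slanted face \<open>v\<close> is parallel to \<open>(0, 1, 1)\<close>:
      its first entry is zero and the other two agree. The combination in the third component of the
      pullback then cancels because \<open>p$2 = 1\<close>.\<close>
    assume y: "p$2 = 1"
    have "1 / (1 + p$3) + p$3 / (1 + p$3) = 1" using z by (simp add: field_simps)
    then show ?thesis using y face[of "vector [0, 1, 1]" 1] z by (simp add: simps pullback1_phi)
  qed
  show "pullback1 phi v p $ 2 = 0 \<and> pullback1 phi v p $ 3 = 0" if "p$1 = 0 \<or> p$1 = 1"
    using that
  proof
    assume "p$1 = 0"
    then show ?thesis using face[of "vector [-1, 0, 0]" 0] z by (simp add: simps pullback1_phi)
  next
    assume x: "p$1 = 1"
    have "1 / (1 + p$3) + p$3 / (1 + p$3) = 1" using z by (simp add: field_simps)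
    then show ?thesis using x face[of "vector [1, 0, 1]" 1] z by (simp add: simps pullback1_phi)
  qed
  show "pullback1 phi v p $ 1 = 0 \<and> pullback1 phi v p $ 2 = 0" if "p$3 = 0"
    using that face[of "vector [0, 0, -1]" 0] by (simp add: simps pullback1_phi)
qed

subsection \<open>Coefficients in the vertical variable\<close>

lemma sum_swap3:
  "(\<Sum>i\<in>I. \<Sum>j\<in>J. \<Sum>s\<in>S. F i j s) = (\<Sum>s\<in>S. \<Sum>i\<in>I. \<Sum>j\<in>J. F i j s)"
proof -
  have "(\<Sum>i\<in>I. \<Sum>j\<in>J. \<Sum>s\<in>S. F i j s) = (\<Sum>i\<in>I. \<Sum>s\<in>S. \<Sum>j\<in>J. F i j s)"
    by (rule sum.cong[OF refl]) (rule sum.swap)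
  also have "\<dots> = (\<Sum>s\<in>S. \<Sum>i\<in>I. \<Sum>j\<in>J. F i j s)" by (rule sum.swap)
  finally show ?thesis .
qed

lemma Q_imp_polyfun_z:
  assumes "u \<in> Q l m n"
  obtains c where "\<And>s. c s \<in> Q2 l m"
    "u = (\<lambda>p. \<Sum>s<nat (n + 1). c s (p$1) (p$2) * (p$3)^s)"
proof -
  obtain d :: "nat \<Rightarrow> nat \<Rightarrow> nat \<Rightarrow> real" where u: "u = (\<lambda>p.
     \<Sum>i<nat (l + 1). \<Sum>j<nat (m + 1). \<Sum>s<nat (n + 1). d i j s * (p$1)^i * (p$2)^j * (p$3)^s)"
    using assms unfolding Q_def by blast
  define c where "c s = (\<lambda>x y. \<Sum>i<nat (l + 1). \<Sum>j<nat (m + 1). d i j s * x^i * y^j)" for s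
  have "c s \<in> Q2 l m" for s unfolding c_def by (rule Q2_I)
  moreover have "u = (\<lambda>p. \<Sum>s<nat (n + 1). c s (p$1) (p$2) * (p$3)^s)"
    unfolding u c_def sum_distrib_right
    by (rule ext) (rule sum_swap3)
  ultimately show thesis using that by blast
qed

lemma polyfun_z_in_Q:
  assumes "\<And>s. c s \<in> Q2 l m"
  shows "(\<lambda>p. \<Sum>s<nat (n + 1). c s (p$1) (p$2) * (p$3)^s) \<in> Q l m n"
proof -
  have "\<forall>s. \<exists>d :: nat \<Rightarrow> nat \<Rightarrow> real. c s = (\<lambda>x y. \<Sum>i<nat (l + 1). \<Sum>j<nat (m + 1). d i j * x^i * y^j)"
    using assms unfolding Q2_def by blast
  from choice[OF this] obtain d :: "nat \<Rightarrow> nat \<Rightarrow> nat \<Rightarrow> real"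
    where d: "\<forall>s. c s = (\<lambda>x y. \<Sum>i<nat (l + 1). \<Sum>j<nat (m + 1). d s i j * x^i * y^j)" ..
  note c = d[rule_format]
  have "(\<lambda>p::real^3. \<Sum>s<nat (n + 1). c s (p$1) (p$2) * (p$3)^s) = (\<lambda>p.
     \<Sum>i<nat (l + 1). \<Sum>j<nat (m + 1). \<Sum>s<nat (n + 1). d s i j * (p$1)^i * (p$2)^j * (p$3)^s)"
    unfolding c sum_distrib_right
    by (rule ext) (rule sum_swap3[symmetric])
  then show ?thesis
    unfolding Q_def mem_Collect_eq by (rule exI[of _ "\<lambda>i j s. d s i j"])
qed

text \<open>The special term occupies exactly the degrees that the three polynomial spaces leave
  free: \<open>z^k\<close> in the first two components and \<open>z^(k-1)\<close> in the third. So
  \<open>r\<close> can be stored as \<open>A k\<close>, \<open>B k\<close> and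
  \<open>- C (k-1)\<close>, and the two derivative conditions record that these come from one
  polynomial.\<close>

lemma U1_inf_coefficients:
  assumes E: "E \<in> U1_inf k" and k: "k \<ge> 1"
  obtains A B C where
    "\<And>s. A s \<in> Q2 (int k - 1) (int k)" "\<And>s. B s \<in> Q2 (int k) (int k - 1)"
    "\<And>s. C s \<in> Q2 (int k) (int k)"
    "\<And>x y. ((\<lambda>x. C (k-1) x y) has_real_derivative - A k x y) (at x)"
    "\<And>x y. ((\<lambda>y. C (k-1) x y) has_real_derivative - B k x y) (at y)"
    "\<And>p. E p $ 1 = (\<Sum>s<Suc k. A s (p$1) (p$2) * (p$3)^s) / (1 + p$3)^(k+1)"
    "\<And>p. E p $ 2 = (\<Sum>s<Suc k. B s (p$1) (p$2) * (p$3)^s) / (1 + p$3)^(k+1)"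
    "\<And>p. E p $ 3 = (\<Sum>s<k. C s (p$1) (p$2) * (p$3)^s) / (1 + p$3)^(k+1)"
proof -
  obtain j where j: "k = Suc j" using k by (cases k) auto
  obtain a b c r where a: "a \<in> Qw (k + 1) (int k - 1) (int k) (int k - 1)"
    and b: "b \<in> Qw (k + 1) (int k) (int k - 1) (int k - 1)"
    and c: "c \<in> Qw (k + 1) (int k) (int k) (int k - 2)"
    and r: "r \<in> Q2 (int k) (int k)"
    and E: "E = (\<lambda>p. vector [a p, b p, c p] +
               ((p$3)^(k - 1) / (1 + p$3)^(k + 1)) *\<^sub>R
                 vector [deriv (\<lambda>x. r x (p$2)) (p$1) * p$3,
                         deriv (\<lambda>y. r (p$1) y) (p$2) * p$3,
                         - r (p$1) (p$2)])"
    using E[unfolded U1_inf_def mem_Collect_eq, THEN conjunct1]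
    by (elim bexE) (rule that)
  obtain a' where aQ: "a' \<in> Q (int k - 1) (int k) (int k - 1)" and a': "a = (\<lambda>p. a' p / (1 + p$3)^(k+1))"
    using a unfolding Qw_def by blast
  obtain A where A: "\<And>s. A s \<in> Q2 (int k - 1) (int k)"
    and a'': "a' = (\<lambda>p. \<Sum>s<nat (int k - 1 + 1). A s (p$1) (p$2) * (p$3)^s)"
    by (rule Q_imp_polyfun_z[OF aQ]) (rule that)
  obtain b' where bQ: "b' \<in> Q (int k) (int k - 1) (int k - 1)" and b': "b = (\<lambda>p. b' p / (1 + p$3)^(k+1))"
    using b unfolding Qw_def by blast
  obtain B where B: "\<And>s. B s \<in> Q2 (int k) (int k - 1)"
    and b'': "b' = (\<lambda>p. \<Sum>s<nat (int k - 1 + 1). B s (p$1) (p$2) * (p$3)^s)"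
    by (rule Q_imp_polyfun_z[OF bQ]) (rule that)
  obtain c' where cQ: "c' \<in> Q (int k) (int k) (int k - 2)" and c': "c = (\<lambda>p. c' p / (1 + p$3)^(k+1))"
    using c unfolding Qw_def by blast
  obtain C where C: "\<And>s. C s \<in> Q2 (int k) (int k)"
    and c'': "c' = (\<lambda>p. \<Sum>s<nat (int k - 2 + 1). C s (p$1) (p$2) * (p$3)^s)"
    by (rule Q_imp_polyfun_z[OF cQ]) (rule that)
  obtain rx where rx: "rx \<in> Q2 (int k - 1) (int k)" "\<And>x y. ((\<lambda>x. r x y) has_real_derivative rx x y) (at x)"
    by (rule Q2_has_derivative_x[OF r]) (rule that)
  obtain ry where ry: "ry \<in> Q2 (int k) (int k - 1)" "\<And>x y. ((\<lambda>y. r x y) has_real_derivative ry x y) (at y)"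
    by (rule Q2_has_derivative_y[OF r]) (rule that)
  define A' where "A' = A(k := rx)"
  define B' where "B' = B(k := ry)"
  define C' where "C' = C(k-1 := (\<lambda>x y. - r x y))"
  have mr: "(\<lambda>x y. - r x y) \<in> Q2 (int k) (int k)"
    using Q2_lincomb[OF r r, of "-1" 0] by simp
  have n: "nat (int k - 1 + 1) = k" "nat (int k - 2 + 1) = j" using j by auto
  have dr: "deriv (\<lambda>x. r x y) x = rx x y" "deriv (\<lambda>y. r x y) y = ry x y" for x y
    using rx(2) ry(2) by (auto intro: DERIV_imp_deriv)
  show thesis
  proof (rule that[of A' B' C'])
    show "A' s \<in> Q2 (int k - 1) (int k)" for s using A rx(1) by (simp add: A'_def)
    show "B' s \<in> Q2 (int k) (int k - 1)" for s using B ry(1) by (simp add: B'_def)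
    show "C' s \<in> Q2 (int k) (int k)" for s using C mr by (simp add: C'_def)
    show "((\<lambda>x. C' (k-1) x y) has_real_derivative - A' k x y) (at x)" for x y
      using DERIV_minus[OF rx(2)] by (simp add: A'_def C'_def)
    show "((\<lambda>y. C' (k-1) x y) has_real_derivative - B' k x y) (at y)" for x y
      using DERIV_minus[OF ry(2)] by (simp add: B'_def C'_def)
    fix p
    have "(\<Sum>s<Suc k. A' s (p$1) (p$2) * (p$3)^s) = a' p + (p$3)^j * (rx (p$1) (p$2) * p$3)"
      by (simp add: A'_def a'' n) (simp add: j)
    then show "E p $ 1 = (\<Sum>s<Suc k. A' s (p$1) (p$2) * (p$3)^s) / (1 + p$3)^(k+1)"
      by (simp add: E a' dr j add_divide_distrib)
    have "(\<Sum>s<Suc k. B' s (p$1) (p$2) * (p$3)^s) = b' p + (p$3)^j * (ry (p$1) (p$2) * p$3)"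
      by (simp add: B'_def b'' n) (simp add: j)
    then show "E p $ 2 = (\<Sum>s<Suc k. B' s (p$1) (p$2) * (p$3)^s) / (1 + p$3)^(k+1)"
      by (simp add: E b' dr j add_divide_distrib)
    have "(\<Sum>s<k. C' s (p$1) (p$2) * (p$3)^s) = c' p - (p$3)^j * r (p$1) (p$2)"
      unfolding j by (simp add: C'_def c'' n j)
    then show "E p $ 3 = (\<Sum>s<k. C' s (p$1) (p$2) * (p$3)^s) / (1 + p$3)^(k+1)"
      by (simp add: E c' j diff_divide_distrib)
  qed
qed

text \<open>The recursion solves, from the top coefficient downwards, for the potential whose
  \<open>z\<close>-derivative has the prescribed coefficients in every positive degree.\<close>

lemma potential_coefficients:
  fixes C :: "nat \<Rightarrow> real \<Rightarrow> real \<Rightarrow> real"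
  assumes C: "\<And>s. C s \<in> Q2 l m"
  obtains T where "\<And>s. T s \<in> Q2 l m" "T 0 = (\<lambda>x y. 0)" "T k = (\<lambda>x y. 0)"
    "\<And>s x y. 1 \<le> s \<Longrightarrow> s < k \<Longrightarrow> real (k - s) * T s x y = real (Suc s) * T (Suc s) x y - C s x y"
    "\<And>s x y. \<forall>i<k. C i x y = 0 \<Longrightarrow> T s x y = 0"
proof -
  \<comment> \<open>\<open>H n\<close> is the coefficient at distance \<open>n\<close> from the top,
    that is \<open>T (k - n)\<close> for \<open>n < k\<close>. With \<open>s = k - Suc n\<close>,
    solving the relation at \<open>s\<close> means dividing by \<open>k - s = Suc n\<close>.\<close>
  define H :: "nat \<Rightarrow> real \<Rightarrow> real \<Rightarrow> real" where
    "H = rec_nat (\<lambda>x y. 0) (\<lambda>n h x y. (real (k - n) / real (Suc n)) * h x y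
        + (- 1 / real (Suc n)) * C (k - Suc n) x y)"
  have H0: "H 0 = (\<lambda>x y. 0)" by (simp add: H_def)
  have HS: "H (Suc n) = (\<lambda>x y. (real (k - n) / real (Suc n)) * H n x y
        + (- 1 / real (Suc n)) * C (k - Suc n) x y)" for n
    by (simp add: H_def)
  have HQ: "H n \<in> Q2 l m" for n
    by (induction n) (simp add: H0 Q2_zero, simp only: HS Q2_lincomb C)
  \<comment> \<open>The recursion is pointwise in \<open>x\<close> and \<open>y\<close>, so zero
    boundary values of all \<open>C i\<close> are inherited by the potential.\<close>
  have Hz: "H n x y = 0" if "n \<le> k" "\<And>i. i < k \<Longrightarrow> C i x y = 0" for n x y
    using that(1) by (induction n) (simp_all add: H0 HS that(2))
  \<comment> \<open>The recursion would prescribe a value at \<open>s = 0\<close> as well. It is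
    overridden by 0, for the trace on the base, and the relation is claimed only from
    \<open>s = 1\<close> on.\<close>
  define T where "T s = (if s = 0 then (\<lambda>x y. 0) else H (k - s))" for s
  show thesis
  proof (rule that[of T])
    show "T s \<in> Q2 l m" for s by (simp add: T_def HQ Q2_zero)
    show "T 0 = (\<lambda>x y. 0)" "T k = (\<lambda>x y. 0)" by (simp_all add: T_def H0)
    show "T s x y = 0" if "\<forall>i<k. C i x y = 0" for s x y
      using Hz that by (simp add: T_def)
    show "real (k - s) * T s x y = real (Suc s) * T (Suc s) x y - C s x y" if s: "1 \<le> s" "s < k" for s x y
    proof -
      define n where "n = k - Suc s"
      have n: "k - s = Suc n" "k - n = Suc s" "k - Suc n = s" "k - Suc s = n" using s by (auto simp: n_def)
      have "T s x y = (real (Suc s) / real (Suc n)) * H n x y + (- 1 / real (Suc n)) * C s x y"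
        using s by (simp only: T_def n HS) simp
      moreover have "T (Suc s) x y = H n x y" by (simp add: T_def n)
      ultimately show ?thesis unfolding n by (simp add: field_simps del: of_nat_Suc)
    qed
  qed
qed

text \<open>The numerator of the derivative of \<open>z^s / (1 + z)^k\<close> equals
  \<open>s * z^(s-1) - (k - s) * z^s\<close>, and an index shift collects equal powers. The shift
  runs one index too far, whence the last term; it disappears in the application, where
  \<open>n = k\<close> and \<open>T k = 0\<close>.\<close>

lemma sum_derivative_coefficients:
  fixes T :: "nat \<Rightarrow> real"
  shows "(\<Sum>s<n. T s * (real s * z^(s-1) * (1 + z) - real k * z^s)) =
    (\<Sum>s<n. (real (Suc s) * T (Suc s) - (real k - real s) * T s) * z^s) - real n * T n * z^(n-1)"
proof (induction n)
  case (Suc n)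
  \<comment> \<open>Here \<open>p\<close> and \<open>w\<close> stand for \<open>z^(n-1)\<close> and
    \<open>z^n\<close>. The premise also holds for \<open>n = 0\<close>, where the exponent is
    truncated but the factor \<open>a = real n\<close> is zero.\<close>
  have *: "a * p * z = a * w \<Longrightarrow> (S - a * t * p) + t * (a * p * (1 + z) - c * w)
      = (S + (b * u - (c - a) * t) * w) - b * u * w" for a b c p S t u w :: real
    by algebra
  have "real n * z^(n-1) * z = real n * z^n" by (cases n) auto
  then show ?case unfolding sum.lessThan_Suc Suc.IH diff_Suc_1 by (rule *)
qed auto

lemma DERIV_z_power:
  fixes z :: real
  assumes "z \<ge> 0" "k \<ge> 1"
  shows "((\<lambda>t. (z + t)^s / (1 + (z + t))^k) has_real_derivative
    ((real s * z^(s-1) * (1 + z) - real k * z^s) / (1 + z)^(k+1))) (at 0)"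
proof -
  obtain j where j: "k = Suc j" using assms by (cases k) auto
  have "((\<lambda>t. (z + t)^s / (1 + (z + t))^k) has_real_derivative
    ((real s * z^(s-1)) * (1 + z)^k - z^s * (real k * (1 + z)^(k-1))) / ((1 + z)^k * (1 + z)^k)) (at 0)"
    using assms by (auto intro!: derivative_eq_intros)
  moreover have "(a * c^k - b * (real k * c^(k-1))) / (c^k * c^k) = (a * c - real k * b) / c^(k+1)"
    if "c \<noteq> 0" for a b c :: real
    using that by (simp add: j field_simps)
  ultimately show ?thesis using assms by simp
qed

text \<open>The coefficient of \<open>z^(s+1)\<close> in the difference is
  \<open>A (s+1) - Tx (s+1) - Tx s\<close>. Degree 0 drops out by the trace on the base, degree
  \<open>k\<close> by \<open>top\<close>, and every coefficient in between vanishes at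
  \<open>y = 0\<close> and \<open>y = 1\<close>. The second component is covered by exchanging the
  variables.\<close>

lemma trace_zero_component:
  fixes A T Tx :: "nat \<Rightarrow> real \<Rightarrow> real \<Rightarrow> real"
  assumes k: "k \<ge> 1"
    and A: "\<And>s. A s \<in> Q2 l m" and T: "\<And>s. T s \<in> Q2 l' m'" and Tx: "\<And>s. Tx s \<in> Q2 l m"
    and der: "\<And>s x y. ((\<lambda>x. T s x y) has_real_derivative Tx s x y) (at x)"
    and T0: "T 0 = (\<lambda>x y. 0)" and top: "\<And>x y. A k x y = Tx (k-1) x y"
    and Tb: "\<And>s x b. x \<in> {0..1} \<Longrightarrow> b \<in> {0,1} \<Longrightarrow> T s x b = 0"
    and Ab: "\<And>s x b. s < Suc k \<Longrightarrow> x \<in> {0..1} \<Longrightarrow> b \<in> {0,1} \<Longrightarrow> A s x b = 0"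
    and A0: "\<And>x y. x \<in> {0..1} \<Longrightarrow> y \<in> {0..1} \<Longrightarrow> A 0 x y = 0"
  obtains g where "\<And>s. g s \<in> Q2 l (m - 2)"
    "\<And>x y z. x \<in> {0..1} \<Longrightarrow> y \<in> {0..1} \<Longrightarrow>
      (\<Sum>s<Suc k. A s x y * z^s) - (1 + z) * (\<Sum>s<k. Tx s x y * z^s)
        = y * (1 - y) * z * (\<Sum>s<k-1. g s x y * z^s)"
proof -
  obtain j where j: "k = Suc j" using k by (cases k) auto
  have Tx0: "Tx 0 x y = 0" for x y
    using der[of 0 y x] DERIV_unique[OF _ DERIV_const] by (simp add: T0)
  have Txb: "Tx s x b = 0" if "b \<in> {0,1}" for s x b
  proof -
    have "infinite {0..1::real}" by (simp add: infinite_Icc)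
    then have "(\<lambda>x. T s x b) = (\<lambda>x. 0)"
      using Q2_slice_y_eq_0[OF T] Tb[OF _ that] by blast
    then show ?thesis using der[of s b x] DERIV_unique[OF _ DERIV_const] by simp
  qed
  \<comment> \<open>The coefficient of \<open>z^(s+1)\<close> for \<open>s < k - 1\<close>, written
    in the shape of \<open>Q2_lincomb\<close>.\<close>
  define D where "D s x y = 1 * (1 * A (Suc s) x y + (-1) * Tx (Suc s) x y) + (-1) * Tx s x y" for s x y
  have D: "D s \<in> Q2 l m" for s
    unfolding D_def by (intro Q2_lincomb A Tx)
  have "\<exists>g. g \<in> Q2 l (m - 2) \<and> (\<forall>x y. s < j \<longrightarrow> D s x y = y * (1 - y) * g x y)" for s
  proof (cases "s < j")
    case True
    then have "D s x b = 0" if "x \<in> {0..1}" "b \<in> {0,1}" for x b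
      using that Ab[of "Suc s" x b] Txb[of b] by (simp add: D_def j)
    then show ?thesis using Q2_factor_y[OF D] by metis
  next
    case False
    then show ?thesis using Q2_zero by blast
  qed
  then obtain g where g: "\<And>s. g s \<in> Q2 l (m - 2)"
    "\<And>s x y. s < j \<Longrightarrow> D s x y = y * (1 - y) * g s x y" by metis
  show thesis
  proof (rule that[OF g(1)])
    fix x y z :: real assume xy: "x \<in> {0..1}" "y \<in> {0..1}"
    have a: "(\<Sum>s<Suc k. A s x y * z^s) = A 0 x y + (\<Sum>s<k. A (Suc s) x y * z^Suc s)"
      by (subst sum.lessThan_Suc_shift) simp
    have b: "(\<Sum>s<k. Tx s x y * z^s) = Tx 0 x y + (\<Sum>s<j. Tx (Suc s) x y * z^Suc s)"
      unfolding j by (subst sum.lessThan_Suc_shift) simp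
    have c: "z * (\<Sum>s<k. Tx s x y * z^s) = (\<Sum>s<k. Tx s x y * z^Suc s)"
      by (simp add: sum_distrib_left mult_ac)
    have d: "(1 + z) * (\<Sum>s<k. Tx s x y * z^s) = (\<Sum>s<k. Tx s x y * z^s) + z * (\<Sum>s<k. Tx s x y * z^s)"
      by (simp only: ring_distribs mult_1_left)
    have "(\<Sum>s<Suc k. A s x y * z^s) - (1 + z) * (\<Sum>s<k. Tx s x y * z^s)
      = (\<Sum>s<k. A (Suc s) x y * z^Suc s) - (\<Sum>s<j. Tx (Suc s) x y * z^Suc s)
        - (\<Sum>s<k. Tx s x y * z^Suc s)"
      using a b c d A0[OF xy] Tx0[of x y] by linarith
    also have "\<dots> = (\<Sum>s<j. D s x y * z^Suc s) + (A k x y - Tx j x y) * z^k"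
      by (simp add: j D_def sum.distrib sum_subtractf algebra_simps del: power_Suc)
    also have "\<dots> = (\<Sum>s<j. D s x y * z^Suc s)" using top[of x y] j by simp
    also have "\<dots> = (\<Sum>s<j. y * (1 - y) * g s x y * z^Suc s)"
      by (intro sum.cong refl) (simp add: g(2))
    also have "\<dots> = y * (1 - y) * z * (\<Sum>s<k-1. g s x y * z^s)"
      by (simp add: j sum_distrib_left mult_ac)
    finally show "(\<Sum>s<Suc k. A s x y * z^s) - (1 + z) * (\<Sum>s<k. Tx s x y * z^s)
        = y * (1 - y) * z * (\<Sum>s<k-1. g s x y * z^s)" .
  qed
qed

subsection \<open>The potential and the decomposition\<close>

text \<open>The substitution \<open>z = t / (1 - t)\<close>, under which
  \<open>1 + z = 1 / (1 - t)\<close>. The bound on \<open>N\<close> ensures that no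
  \<open>n - s\<close> is truncated, so only nonnegative powers of \<open>1 - t\<close>
  occur.\<close>

lemma sum_z_eq_zeta:
  fixes a :: "nat \<Rightarrow> real"
  assumes t: "t < 1" and N: "N \<le> Suc n"
  shows "(\<Sum>s<N. a s * (t / (1 - t))^s) / (1 + t / (1 - t))^n = (\<Sum>s<N. a s * (t^s * (1 - t)^(n - s)))"
  unfolding sum_divide_distrib
proof (rule sum.cong[OF refl])
  fix s assume "s \<in> {..<N}"
  then have s: "(1 - t)^n = (1 - t)^(n - s) * (1 - t)^s" using N by (simp flip: power_add)
  have "1 + t / (1 - t) = 1 / (1 - t)" using t by (simp add: field_simps)
  then show "a s * (t / (1 - t))^s / (1 + t / (1 - t))^n = a s * (t^s * (1 - t)^(n - s))"
    using t by (simp add: power_divide s)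
qed

lemma Q2_differentiable:
  fixes X Y :: "real^3 \<Rightarrow> real"
  assumes "f \<in> Q2 l m" "X differentiable (at p)" "Y differentiable (at p)"
  shows "(\<lambda>p. f (X p) (Y p)) differentiable (at p)"
proof -
  obtain c where f: "f = (\<lambda>x y. \<Sum>i<nat (l + 1). \<Sum>j<nat (m + 1). c i j * x^i * y^j)"
    using assms(1) unfolding Q2_def by blast
  show ?thesis unfolding f
    by (intro differentiable_sum differentiable_mult differentiable_const differentiable_power assms finite_lessThan ballI)
qed

lemma Q2_bounded_unit_square:
  assumes "f \<in> Q2 l m"
  obtains M where "\<And>x y. x \<in> {0..1} \<Longrightarrow> y \<in> {0..1} \<Longrightarrow> \<bar>f x y\<bar> \<le> M"
proof -
  obtain c where f: "f = (\<lambda>x y. \<Sum>i<nat (l + 1). \<Sum>j<nat (m + 1). c i j * x^i * y^j)"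
    using assms(1) unfolding Q2_def by blast
  have "\<bar>f x y\<bar> \<le> (\<Sum>i<nat (l + 1). \<Sum>j<nat (m + 1). \<bar>c i j\<bar>)" if "x \<in> {0..1}" "y \<in> {0..1}" for x y
    unfolding f
  proof (intro order_trans[OF sum_abs] sum_mono)
    fix i j
    have "\<bar>x^i\<bar> \<le> 1" "\<bar>y^j\<bar> \<le> 1" using that by (auto simp: power_abs intro!: power_le_one)
    then have "\<bar>c i j\<bar> * \<bar>x^i\<bar> * \<bar>y^j\<bar> \<le> \<bar>c i j\<bar> * 1 * 1" by (intro mult_mono) auto
    then show "\<bar>c i j * x^i * y^j\<bar> \<le> \<bar>c i j\<bar>" by (simp add: abs_mult)
  qed
  then show thesis by (rule that)
qed

text \<open>Undoing the pullback multiplies the first two components by \<open>1 + z\<close>, and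
  the third, after a correction by the other two, by \<open>(1 + z)^2\<close>. Denominators
  \<open>(1 + z)^k\<close> and \<open>(1 + z)^(k-1)\<close> remain, matching the numerator degrees
  \<open>k\<close> and \<open>k - 1\<close>. Hence negative powers of \<open>1 - p$3\<close> occur
  only inside the two ratios.\<close>

lemma U1_subset_Hcurl:
  assumes v: "v \<in> U1 k" and k: "k \<ge> 1"
  shows "v \<in> Hcurl (interior pyramid)"
proof -
  obtain E where E: "E \<in> U1_inf k" and vE: "\<forall>p \<in> pyramid_inf. pullback1 phi v p = E p"
    using v unfolding U1_def mem_Collect_eq by (elim bexE) (rule that)
  obtain A B C where A: "\<And>s. A s \<in> Q2 (int k - 1) (int k)" and B: "\<And>s. B s \<in> Q2 (int k) (int k - 1)"
    and C: "\<And>s. C s \<in> Q2 (int k) (int k)"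
    and "\<And>x y. ((\<lambda>x. C (k-1) x y) has_real_derivative - A k x y) (at x)"
    and "\<And>x y. ((\<lambda>y. C (k-1) x y) has_real_derivative - B k x y) (at y)"
    and E1: "\<And>p. E p $ 1 = (\<Sum>s<Suc k. A s (p$1) (p$2) * (p$3)^s) / (1 + p$3)^(k+1)"
    and E2: "\<And>p. E p $ 2 = (\<Sum>s<Suc k. B s (p$1) (p$2) * (p$3)^s) / (1 + p$3)^(k+1)"
    and E3: "\<And>p. E p $ 3 = (\<Sum>s<k. C s (p$1) (p$2) * (p$3)^s) / (1 + p$3)^(k+1)"
    by (rule U1_inf_coefficients[OF E k]) (rule that)
  let ?X = "\<lambda>p::real^3. p$1 / (1 - p$3)" and ?Y = "\<lambda>p::real^3. p$2 / (1 - p$3)"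
  have om: "tameable (\<lambda>p. 1 - p$3)"
    using tameable_add[OF tameable_const[of 1] tameable_mult[OF tameable_const[of "-1"] tameable_coord3]] by simp
  define f1 where "f1 p = (\<Sum>s<Suc k. A s (?X p) (?Y p) * ((p$3)^s * (1 - p$3)^(k - s)))" for p :: "real^3"
  define f2 where "f2 p = (\<Sum>s<Suc k. B s (?X p) (?Y p) * ((p$3)^s * (1 - p$3)^(k - s)))" for p :: "real^3"
  define f3 where "f3 p = (\<Sum>s<k. C s (?X p) (?Y p) * ((p$3)^s * (1 - p$3)^(k - 1 - s)))
     + (?X p * f1 p + ?Y p * f2 p)" for p :: "real^3"
  have t1: "tameable f1"
    unfolding f1_def
    by (intro tameable_sum tameable_mult tameable_Q2[OF A] tameable_power tameable_coord3 om)
  have t2: "tameable f2"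
    unfolding f2_def
    by (intro tameable_sum tameable_mult tameable_Q2[OF B] tameable_power tameable_coord3 om)
  have XY: "tameable ?X" "tameable ?Y" by (auto intro: tameable_ratio)
  have t3: "tameable f3"
    unfolding f3_def
    by (intro tameable_add tameable_sum tameable_mult tameable_Q2[OF C] tameable_power tameable_coord3 om t1 t2 XY)
  obtain f1' f2' f3' where tame: "tame f1 f1'" "tame f2 f2'" "tame f3 f3'"
    using t1 t2 t3 unfolding tameable_def by blast
  show ?thesis
  proof (rule Hcurl_tame[OF tame])
    fix p assume p: "p \<in> interior pyramid"
    then have t: "p$3 < 1" and pa: "p \<in> pyramid - {apex}"
      using interior_pyramid_bounds[OF p] unfolding pyramid_minus_apex by auto
    \<comment> \<open>The value of \<open>1 + z\<close> at \<open>phi_inv p\<close>, kept opaque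
      while its powers are cancelled.\<close>
    define c where "c = 1 + p$3 / (1 - p$3)"
    have q: "phi_inv p $ 1 = ?X p" "phi_inv p $ 2 = ?Y p" "phi_inv p $ 3 = p$3 / (1 - p$3)"
      by (simp_all add: phi_inv_def)
    have q3: "phi_inv p $ 3 \<ge> 0" using phi_inv(1)[OF pa] by (simp add: pyramid_inf_def)
    then have c: "c > 0" by (simp add: c_def q)
    have Ev: "E (phi_inv p) = pullback1 phi v (phi_inv p)" using vE phi_inv(1)[OF pa] by simp
    have e: "E (phi_inv p) $ 1 = v p $ 1 / c" "E (phi_inv p) $ 2 = v p $ 2 / c"
      "E (phi_inv p) $ 3 = (v p $ 3 - ?X p * v p $ 1 - ?Y p * v p $ 2) / c^2"
      unfolding Ev pullback1_phi[OF q3] phi_inv(2)[OF pa] unfolding q c_def by simp_all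
    obtain j where j: "k = Suc j" using k by (cases k) auto
    have "v p $ 1 = E (phi_inv p) $ 1 * c" using c by (simp add: e)
    also have "\<dots> = (\<Sum>s<Suc k. A s (?X p) (?Y p) * (p$3 / (1 - p$3))^s) / c^k"
      using c by (simp add: E1 q flip: c_def)
    also have "\<dots> = f1 p" unfolding c_def f1_def by (rule sum_z_eq_zeta[OF t]) simp
    finally have v1: "v p $ 1 = f1 p" .
    have "v p $ 2 = E (phi_inv p) $ 2 * c" using c by (simp add: e)
    also have "\<dots> = (\<Sum>s<Suc k. B s (?X p) (?Y p) * (p$3 / (1 - p$3))^s) / c^k"
      using c by (simp add: E2 q flip: c_def)
    also have "\<dots> = f2 p" unfolding c_def f2_def by (rule sum_z_eq_zeta[OF t]) simp
    finally have v2: "v p $ 2 = f2 p" .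
    have "v p $ 3 - ?X p * v p $ 1 - ?Y p * v p $ 2 = E (phi_inv p) $ 3 * c^2" using c by (simp add: e)
    also have "\<dots> = (\<Sum>s<k. C s (?X p) (?Y p) * (p$3 / (1 - p$3))^s) / c^(k-1)"
      using c by (simp add: E3 q j power2_eq_square flip: c_def)
    also have "\<dots> = (\<Sum>s<k. C s (?X p) (?Y p) * ((p$3)^s * (1 - p$3)^(k - 1 - s)))"
      unfolding c_def by (rule sum_z_eq_zeta[OF t]) simp
    finally have "v p $ 3 = f3 p" unfolding f3_def v1 v2 by linarith
    then show "v p = vector [f1 p, f2 p, f3 p]"
      using v1 v2 by (simp add: vec_eq_iff forall_3)
  qed
qed

section \<open>The discrete potential and its gradient\<close>

definition potential_inf :: "nat \<Rightarrow> (nat \<Rightarrow> real \<Rightarrow> real \<Rightarrow> real) \<Rightarrow> real^3 \<Rightarrow> real" where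
  "potential_inf k T p = (\<Sum>s<k. T s (p$1) (p$2) * (p$3)^s) / (1 + p$3)^k"

text \<open>The push-forward of \<open>potential_inf\<close> in closed form. Since
  \<open>s < k\<close>, every term keeps a factor \<open>1 - p$3\<close>, which yields the value 0
  at the apex whatever the ratios are there.\<close>

definition potential :: "nat \<Rightarrow> (nat \<Rightarrow> real \<Rightarrow> real \<Rightarrow> real) \<Rightarrow> real^3 \<Rightarrow> real" where
  "potential k T p = (\<Sum>s<k. T s (p$1 / (1 - p$3)) (p$2 / (1 - p$3)) * ((p$3)^s * (1 - p$3)^(k - s)))"

lemma potential_phi:
  assumes "p$3 > -1"
  shows "potential k T (phi p) = potential_inf k T p"
proof -
  have t: "phi p $ 3 < 1" using assms by (simp add: phi_def)
  have d: "1 - p$3 / (1 + p$3) = 1 / (1 + p$3)" using assms by (simp add: field_simps)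
  have "phi p $ 1 / (1 - phi p $ 3) = p$1" "phi p $ 2 / (1 - phi p $ 3) = p$2"
    "phi p $ 3 / (1 - phi p $ 3) = p$3"
    using assms by (simp_all add: phi_def d)
  then show ?thesis
    unfolding potential_def potential_inf_def
    using sum_z_eq_zeta[OF t, where N = k and n = k and a = "\<lambda>s. T s (p$1) (p$2)"] by simp
qed

lemma potential_differentiable:
  assumes T: "\<And>s. T s \<in> Q2 l m" and p: "p$3 \<noteq> 1"
  shows "potential k T differentiable (at p)"
proof -
  have nth: "(\<lambda>p::real^3. p$i) differentiable (at p)" for i
    by (rule bounded_linear_imp_differentiable, rule bounded_linear_vec_nth)
  have om: "(\<lambda>p::real^3. 1 - p$3) differentiable (at p)"
    by (intro differentiable_diff differentiable_const nth)
  have XY: "(\<lambda>p. p$i / (1 - p$3)) differentiable (at p)" for i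
    using p by (intro differentiable_divide nth om) auto
  show ?thesis
    unfolding potential_def[abs_def]
    by (intro differentiable_sum differentiable_mult Q2_differentiable[OF T] XY differentiable_power nth om
        finite_lessThan ballI)
qed

lemma closed_pyramid: "closed pyramid"
proof -
  have eq: "pyramid = {p. 0 \<le> p$1} \<inter> {p. 0 \<le> p$2} \<inter> {p. 0 \<le> p$3} \<inter> {p. p$1 \<le> 1 - p$3} \<inter> {p. p$2 \<le> 1 - p$3}"
    by (auto simp: pyramid_def)
  show ?thesis unfolding eq by (intro closed_Int closed_Collect_le continuous_intros)
qed

lemma frontier_pyramid:
  assumes "p \<in> frontier pyramid"
  shows "p \<in> pyramid" "p$1 = 0 \<or> p$2 = 0 \<or> p$3 = 0 \<or> p$1 = 1 - p$3 \<or> p$2 = 1 - p$3"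
proof -
  show p: "p \<in> pyramid" using assms closed_pyramid frontier_subset_closed by blast
  define S where "S = {p::real^3. 0 < p$1} \<inter> {p. 0 < p$2} \<inter> {p. 0 < p$3} \<inter> {p. p$1 < 1 - p$3} \<inter> {p. p$2 < 1 - p$3}"
  have "open S" unfolding S_def by (intro open_Int open_Collect_less continuous_intros)
  moreover have "S \<subseteq> pyramid" by (auto simp: S_def pyramid_def)
  ultimately have "S \<subseteq> interior pyramid" by (rule interior_maximal[rotated])
  then have "p \<notin> S" using assms by (auto simp: frontier_def)
  then show "p$1 = 0 \<or> p$2 = 0 \<or> p$3 = 0 \<or> p$1 = 1 - p$3 \<or> p$2 = 1 - p$3"
    using p by (auto simp: S_def pyramid_def)
qed

lemma ratio_unit:
  assumes "p \<in> pyramid" "p$3 < 1"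
  shows "p$1 / (1 - p$3) \<in> {0..1}" "p$2 / (1 - p$3) \<in> {0..1}"
  using assms by (auto simp: pyramid_def)

lemma potential_apex: "potential k T apex = 0"
  unfolding potential_def by (rule sum.neutral) (simp add: apex_def)

text \<open>The ratios have no limit at the apex but stay in the unit square, so the potential is
  squeezed by a constant multiple of \<open>1 - p$3\<close>.\<close>

lemma potential_continuous_apex:
  assumes T: "\<And>s. T s \<in> Q2 l m"
  shows "continuous (at apex within pyramid) (potential k T)"
proof -
  have "\<forall>s. \<exists>M. \<forall>x\<in>{0..1}. \<forall>y\<in>{0..1}. \<bar>T s x y\<bar> \<le> M"
    using Q2_bounded_unit_square[OF T] by metis
  then obtain M where M: "\<And>s x y. x \<in> {0..1} \<Longrightarrow> y \<in> {0..1} \<Longrightarrow> \<bar>T s x y\<bar> \<le> M s"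
    by metis
  have bound: "norm (potential k T p) \<le> (\<Sum>s<k. M s) * (1 - p$3)"
    if p: "p \<in> pyramid" "p \<noteq> apex" for p
  proof -
    have t: "p$3 < 1" "0 \<le> p$3" using p pyramid_minus_apex[of p] by (auto simp: pyramid_def)
    have "\<bar>T s (p$1 / (1 - p$3)) (p$2 / (1 - p$3)) * ((p$3)^s * (1 - p$3)^(k - s))\<bar> \<le> M s * (1 * (1 - p$3))"
      if "s < k" for s
    proof -
      have "(1 - p$3)^(k - s) \<le> (1 - p$3)^1" using t that by (intro power_decreasing) auto
      then show ?thesis unfolding abs_mult using t
        by (intro mult_mono M ratio_unit p) (auto simp: power_le_one intro: order_trans[OF abs_ge_zero M[of 0 0]])
    qed
    then show ?thesis
      unfolding potential_def real_norm_def sum_distrib_right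
      by (intro order_trans[OF sum_abs] sum_mono) auto
  qed
  have "((\<lambda>p::real^3. (\<Sum>s<k. M s) * (1 - p$3)) \<longlongrightarrow> (\<Sum>s<k. M s) * (1 - apex$3)) (at apex within pyramid)"
    by (intro tendsto_intros)
  then have lim: "((\<lambda>p::real^3. (\<Sum>s<k. M s) * (1 - p$3)) \<longlongrightarrow> 0) (at apex within pyramid)"
    by (simp add: apex_def)
  have "(potential k T \<longlongrightarrow> 0) (at apex within pyramid)"
    by (rule Lim_null_comparison[OF _ lim])
       (use bound in \<open>auto simp: eventually_at_filter intro!: always_eventually\<close>)
  then show ?thesis by (simp add: continuous_within potential_apex)
qed

lemma potential_in_U0_0:
  assumes T: "\<And>s. T s \<in> Q2 (int k) (int k)" and T0: "T 0 = (\<lambda>x y. 0)"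
    and Tb: "\<And>s w b. w \<in> {0..1} \<Longrightarrow> b \<in> {0,1} \<Longrightarrow> T s w b = 0 \<and> T s b w = 0"
  shows "potential k T \<in> U0_0 k"
proof -
  have Q: "potential_inf k T \<in> Qw k (int k) (int k) (int k - 1)"
    using polyfun_z_in_Q[where c = T, OF T, where n = "int k - 1"]
    unfolding Qw_def potential_inf_def[abs_def] by auto
  have P0: "(\<lambda>w z. 0) \<in> Pw k (int k)"
    unfolding Pw_def mem_Collect_eq by (rule exI[of _ "\<lambda>i j. 0"]) simp
  have "potential_inf k T \<in> U0_inf k"
    unfolding U0_inf_def mem_Collect_eq
  proof (intro conjI ballI)
    show "\<exists>q\<in>Qw k (int k) (int k) (int k - 1). \<exists>c. potential_inf k T = (\<lambda>p. q p + c * ((p$3)^k / (1 + p$3)^k))"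
      by (rule bexI[OF _ Q]) (rule exI[of _ 0], simp)
    fix b :: real assume b: "b \<in> {0, 1}"
    show "\<exists>f\<in>Pw k (int k). \<forall>w\<in>{0..1}. \<forall>z\<ge>0. potential_inf k T (vector [w, b, z]) = f w z"
      by (rule bexI[OF _ P0]) (simp add: potential_inf_def Tb[OF _ b])
    show "\<exists>f\<in>Pw k (int k). \<forall>w\<in>{0..1}. \<forall>z\<ge>0. potential_inf k T (vector [b, w, z]) = f w z"
      by (rule bexI[OF _ P0]) (simp add: potential_inf_def Tb[OF _ b])
  qed
  moreover have "\<forall>p\<in>pyramid_inf. pullback0 phi (potential k T) p = potential_inf k T p"
    by (auto simp: pullback0_def pyramid_inf_def potential_phi)
  ultimately have U0: "potential k T \<in> U0 k"
    unfolding U0_def using potential_continuous_apex[where T = T, OF T] by blast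
  have "potential k T p = 0" if p: "p \<in> frontier pyramid" for p
  proof (cases "p = apex")
    case True
    then show ?thesis by (simp add: potential_apex)
  next
    case False
    then have t: "p$3 < 1" using frontier_pyramid(1)[OF p] pyramid_minus_apex[of p] by blast
    note r = ratio_unit[OF frontier_pyramid(1)[OF p] t]
    \<comment> \<open>On the base only the term with \<open>s = 0\<close> could survive, and
      \<open>T 0\<close> is zero. On a lateral face one ratio is 0 or 1, where every
      \<open>T s\<close> vanishes.\<close>
    have "p$3 = 0 \<or> p$1 / (1 - p$3) \<in> {0,1} \<or> p$2 / (1 - p$3) \<in> {0,1}"
      using frontier_pyramid(2)[OF p] t by auto
    then have "T s (p$1 / (1 - p$3)) (p$2 / (1 - p$3)) * ((p$3)^s * (1 - p$3)^(k - s)) = 0" for s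
      using Tb r T0 by (cases "s = 0") auto
    then show ?thesis unfolding potential_def by (intro sum.neutral) blast
  qed
  then show ?thesis unfolding U0_0_def using U0 by blast
qed

text \<open>The second conclusion says that pullback commutes with the gradient. It is phrased
  through derivatives along coordinate lines, which can be computed directly from the formula of
  \<open>potential_inf\<close>.\<close>

lemma potential_gradient:
  assumes T: "\<And>s. T s \<in> Q2 l m"
  obtains G where "has_gradient_on (potential k T) G (pyramid - {apex})"
    "\<And>p i. p \<in> pyramid_inf \<Longrightarrow>
       ((\<lambda>t. potential_inf k T (p + t *\<^sub>R axis i 1)) has_real_derivative pullback1 phi G p $ i) (at 0)"
proof -
  let ?D = "\<lambda>p. frechet_derivative (potential k T) (at p)"
  \<comment> \<open>The vector representing the derivative as an inner product.\<close>
  define G where "G p = adjoint (?D p) 1" for p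
  have der: "(potential k T has_derivative (\<lambda>h. G p \<bullet> h)) (at p)" if "p$3 \<noteq> 1" for p
  proof -
    have D: "(potential k T has_derivative ?D p) (at p)"
      using potential_differentiable[OF T that] by (simp add: frechet_derivative_works)
    have "G p \<bullet> h = ?D p h" for h
      unfolding G_def using adjoint_works[OF has_derivative_linear[OF D], of h 1]
      by (simp add: inner_commute)
    then show ?thesis using D by simp
  qed
  show thesis
  proof (rule that[of G])
    show "has_gradient_on (potential k T) G (pyramid - {apex})"
      unfolding has_gradient_on_def
    proof
      fix p assume "p \<in> pyramid - {apex}"
      then have "p$3 \<noteq> 1" unfolding pyramid_minus_apex by simp
      then show "(potential k T has_derivative (\<bullet>) (G p)) (at p within pyramid - {apex})"
        using der has_derivative_at_withinI by blast
    qed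
    fix p i assume "p \<in> pyramid_inf"
    then have z: "p$3 > -1" and ph: "phi p $ 3 \<noteq> 1"
      by (auto simp: pyramid_inf_def phi_def)
    let ?P = "\<lambda>h. inverse (1 + p$3) *\<^sub>R h - (h$3 / (1 + p$3)^2) *\<^sub>R p"
    have P: "(phi has_derivative ?P) (at p)" using z by (intro phi_has_derivative) auto
    have fd: "frechet_derivative phi (at p) = ?P"
      by (rule frechet_derivative_at[symmetric, OF P])
    have "((\<lambda>x. potential k T (phi x)) has_derivative (\<lambda>h. G (phi p) \<bullet> ?P h)) (at p)"
      by (rule has_derivative_compose[OF P der[OF ph]])
    \<comment> \<open>Both formulas agree on this open half space, so derivatives in a full
      neighbourhood make sense even at boundary points of \<open>pyramid_inf\<close>.\<close>
    moreover have "open {p::real^3. -1 < p$3}"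
      by (intro open_Collect_less continuous_intros)
    ultimately have "(potential_inf k T has_derivative (\<lambda>h. G (phi p) \<bullet> ?P h)) (at p)"
      by (rule has_derivative_transform_within_open) (use z in \<open>auto simp: potential_phi\<close>)
    then have "(potential_inf k T has_derivative (\<lambda>h. G (phi p) \<bullet> ?P h)) (at (p + 0 *\<^sub>R axis i 1))"
      by simp
    from has_derivative_imp_line_DERIV[OF this]
    show "((\<lambda>t. potential_inf k T (p + t *\<^sub>R axis i 1)) has_real_derivative pullback1 phi G p $ i) (at 0)"
      by (simp only: pullback1_nth fd inner_commute)
  qed
qed

lemma potential_inf_derivative_x:
  assumes Tx: "\<And>s x y. ((\<lambda>x. T s x y) has_real_derivative Tx s x y) (at x)"
  shows "((\<lambda>t. potential_inf k T (p + t *\<^sub>R axis 1 1)) has_real_derivative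
    (\<Sum>s<k. Tx s (p$1) (p$2) * (p$3)^s) / (1 + p$3)^k) (at 0)"
proof -
  have "((\<lambda>t. T s (p$1 + t) (p$2)) has_real_derivative Tx s (p$1) (p$2)) (at 0)" for s
    using DERIV_shift[of "\<lambda>x. T s x (p$2)" "Tx s (p$1) (p$2)" 0 "p$1"] Tx by (simp add: add.commute)
  then have "((\<lambda>t. (\<Sum>s<k. T s (p$1 + t) (p$2) * (p$3)^s) / (1 + p$3)^k) has_real_derivative
    (\<Sum>s<k. Tx s (p$1) (p$2) * (p$3)^s) / (1 + p$3)^k) (at 0)"
    by (intro DERIV_cdivide DERIV_sum DERIV_cmult_right)
  then show ?thesis by (simp add: potential_inf_def axis_def)
qed

lemma potential_inf_derivative_y:
  assumes Ty: "\<And>s x y. ((\<lambda>y. T s x y) has_real_derivative Ty s x y) (at y)"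
  shows "((\<lambda>t. potential_inf k T (p + t *\<^sub>R axis 2 1)) has_real_derivative
    (\<Sum>s<k. Ty s (p$1) (p$2) * (p$3)^s) / (1 + p$3)^k) (at 0)"
proof -
  have "((\<lambda>t. T s (p$1) (p$2 + t)) has_real_derivative Ty s (p$1) (p$2)) (at 0)" for s
    using DERIV_shift[of "\<lambda>y. T s (p$1) y" "Ty s (p$1) (p$2)" 0 "p$2"] Ty by (simp add: add.commute)
  then have "((\<lambda>t. (\<Sum>s<k. T s (p$1) (p$2 + t) * (p$3)^s) / (1 + p$3)^k) has_real_derivative
    (\<Sum>s<k. Ty s (p$1) (p$2) * (p$3)^s) / (1 + p$3)^k) (at 0)"
    by (intro DERIV_cdivide DERIV_sum DERIV_cmult_right)
  then show ?thesis by (simp add: potential_inf_def axis_def)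
qed

lemma potential_inf_derivative_z:
  assumes z: "p$3 \<ge> 0" and k: "k \<ge> 1" and Tk: "T k = (\<lambda>x y. 0)"
  shows "((\<lambda>t. potential_inf k T (p + t *\<^sub>R axis 3 1)) has_real_derivative
    (\<Sum>s<k. (real (Suc s) * T (Suc s) (p$1) (p$2) - (real k - real s) * T s (p$1) (p$2)) * (p$3)^s)
      / (1 + p$3)^(k+1)) (at 0)"
proof -
  have "((\<lambda>t. \<Sum>s<k. T s (p$1) (p$2) * ((p$3 + t)^s / (1 + (p$3 + t))^k)) has_real_derivative
    (\<Sum>s<k. T s (p$1) (p$2) * ((real s * (p$3)^(s-1) * (1 + p$3) - real k * (p$3)^s) / (1 + p$3)^(k+1)))) (at 0)"
    by (intro DERIV_sum DERIV_cmult DERIV_z_power[OF z k])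
  moreover have "(\<Sum>s<k. T s (p$1) (p$2) * ((real s * (p$3)^(s-1) * (1 + p$3) - real k * (p$3)^s) / (1 + p$3)^(k+1)))
    = (\<Sum>s<k. T s (p$1) (p$2) * (real s * (p$3)^(s-1) * (1 + p$3) - real k * (p$3)^s)) / (1 + p$3)^(k+1)"
    by (simp only: sum_divide_distrib times_divide_eq_right)
  ultimately show ?thesis
    unfolding sum_derivative_coefficients[of "\<lambda>s. T s (p$1) (p$2)"]
    by (simp add: potential_inf_def axis_def sum_divide_distrib Tk del: of_nat_Suc)
qed

text \<open>Over a fixed boundary point of the square the trace is a polynomial in \<open>z\<close>
  vanishing for all \<open>z \<ge> 0\<close>. The predicate \<open>P\<close> selects the face and
  has to hold along the whole vertical line.\<close>

lemma zero_boundary_coefficients: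
  assumes E: "\<And>p. p \<in> pyramid_inf \<Longrightarrow> P p \<Longrightarrow> (\<Sum>s<n. A s (p$1) (p$2) * (p$3)^s) / (1 + p$3)^m = 0"
    and P: "\<And>z. P (vector [x, y, z])" and xy: "x \<in> {0..1}" "y \<in> {0..1}" and s: "s < n"
  shows "A s x y = 0"
proof (rule real_polyfun_eq_0[where S = "{0..}" and n = n and c = "\<lambda>s. A s x y"])
  show "infinite {0::real..}" by (rule infinite_Ici)
  fix z :: real assume z: "z \<in> {0..}"
  have "vector [x, y, z] \<in> pyramid_inf" using xy z by (simp add: pyramid_inf_def)
  from E[OF this P] show "(\<Sum>s<n. A s x y * z^s) = 0" using z by simp
qed (rule s)

section \<open>Assembly of the decomposition\<close>

lemma pullback1_diff_nth:
  "pullback1 f (\<lambda>p. E p - F p) p $ i = pullback1 f E p $ i - pullback1 f F p $ i"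
  by (simp add: pullback1_nth inner_diff_right)

lemma Qw_I: "u \<in> Q l m n \<Longrightarrow> (\<lambda>p. u p / (1 + p$3)^k) \<in> Qw k l m n"
  unfolding Qw_def by blast

text \<open>The complementary field is defined as \<open>v - G\<close>, so the sum is right by
  construction. The content is that its pullback equals an explicit element \<open>W\<close> of
  \<open>U1_curl0_inf k\<close>.\<close>

lemma Helmholtz_decomposition:
  assumes v: "v \<in> U1_0 k" and k: "k \<ge> 1"
  obtains q w g where "q \<in> U0_0 k" "w \<in> U1_curl0 k" "has_gradient_on q g (pyramid - {apex})"
    "\<And>p. v p = g p + w p"
proof -
  have vU: "v \<in> U1 k" and vt: "zero_tangential v" using v by (auto simp: U1_0_def)
  obtain E where E: "E \<in> U1_inf k" and vE: "\<forall>p \<in> pyramid_inf. pullback1 phi v p = E p"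
    using vU unfolding U1_def mem_Collect_eq by (elim bexE) (rule that)
  obtain A B C where A: "\<And>s. A s \<in> Q2 (int k - 1) (int k)" and B: "\<And>s. B s \<in> Q2 (int k) (int k - 1)"
    and C: "\<And>s. C s \<in> Q2 (int k) (int k)"
    and Ck: "\<And>x y. ((\<lambda>x. C (k-1) x y) has_real_derivative - A k x y) (at x)"
      "\<And>x y. ((\<lambda>y. C (k-1) x y) has_real_derivative - B k x y) (at y)"
    and E1: "\<And>p. E p $ 1 = (\<Sum>s<Suc k. A s (p$1) (p$2) * (p$3)^s) / (1 + p$3)^(k+1)"
    and E2: "\<And>p. E p $ 2 = (\<Sum>s<Suc k. B s (p$1) (p$2) * (p$3)^s) / (1 + p$3)^(k+1)"
    and E3: "\<And>p. E p $ 3 = (\<Sum>s<k. C s (p$1) (p$2) * (p$3)^s) / (1 + p$3)^(k+1)"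
    by (rule U1_inf_coefficients[OF E k]) (rule that)
  have trace: "p$2 = 0 \<or> p$2 = 1 \<Longrightarrow> E p $ 1 = 0 \<and> E p $ 3 = 0"
    "p$1 = 0 \<or> p$1 = 1 \<Longrightarrow> E p $ 2 = 0 \<and> E p $ 3 = 0"
    "p$3 = 0 \<Longrightarrow> E p $ 1 = 0 \<and> E p $ 2 = 0" if "p \<in> pyramid_inf" for p
    using zero_tangential_pullback1[OF vt that] vE that by simp_all
  have Ay: "A s x b = 0" if "s < Suc k" "x \<in> {0..1}" "b \<in> {0,1}" for s x b
  proof (rule zero_boundary_coefficients[where A = A and n = "Suc k" and m = "k + 1" and P = "\<lambda>p. p$2 = 0 \<or> p$2 = 1"])
    show "(\<Sum>s<Suc k. A s (p$1) (p$2) * (p$3)^s) / (1 + p$3)^(k+1) = 0"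
      if "p \<in> pyramid_inf" "p$2 = 0 \<or> p$2 = 1" for p
      using trace(1)[OF that] unfolding E1 by (rule conjunct1)
  qed (use that in auto)
  have Bx: "B s b y = 0" if "s < Suc k" "y \<in> {0..1}" "b \<in> {0,1}" for s y b
  proof (rule zero_boundary_coefficients[where A = B and n = "Suc k" and m = "k + 1" and P = "\<lambda>p. p$1 = 0 \<or> p$1 = 1"])
    show "(\<Sum>s<Suc k. B s (p$1) (p$2) * (p$3)^s) / (1 + p$3)^(k+1) = 0"
      if "p \<in> pyramid_inf" "p$1 = 0 \<or> p$1 = 1" for p
      using trace(2)[OF that] unfolding E2 by (rule conjunct1)
  qed (use that in auto)
  have Cy: "C s x b = 0" if "s < k" "x \<in> {0..1}" "b \<in> {0,1}" for s x b
  proof (rule zero_boundary_coefficients[where A = C and n = "k" and m = "k + 1" and P = "\<lambda>p. p$2 = 0 \<or> p$2 = 1"])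
    show "(\<Sum>s<k. C s (p$1) (p$2) * (p$3)^s) / (1 + p$3)^(k+1) = 0"
      if "p \<in> pyramid_inf" "p$2 = 0 \<or> p$2 = 1" for p
      using trace(1)[OF that] unfolding E3 by (rule conjunct2)
  qed (use that in auto)
  have Cx: "C s b y = 0" if "s < k" "y \<in> {0..1}" "b \<in> {0,1}" for s y b
  proof (rule zero_boundary_coefficients[where A = C and n = "k" and m = "k + 1" and P = "\<lambda>p. p$1 = 0 \<or> p$1 = 1"])
    show "(\<Sum>s<k. C s (p$1) (p$2) * (p$3)^s) / (1 + p$3)^(k+1) = 0"
      if "p \<in> pyramid_inf" "p$1 = 0 \<or> p$1 = 1" for p
      using trace(2)[OF that] unfolding E3 by (rule conjunct2)
  qed (use that in auto)
  have AB0: "A 0 x y = 0 \<and> B 0 x y = 0" if "x \<in> {0..1}" "y \<in> {0..1}" for x y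
  proof -
    have "vector [x, y, 0] \<in> pyramid_inf" using that by (simp add: pyramid_inf_def)
    from trace(3)[OF this] show ?thesis by (simp add: E1 E2 sum.lessThan_Suc_shift del: sum.lessThan_Suc)
  qed
  obtain T where T: "\<And>s. T s \<in> Q2 (int k) (int k)" and T0: "T 0 = (\<lambda>x y. 0)" and Tk: "T k = (\<lambda>x y. 0)"
    and Trec: "\<And>s x y. 1 \<le> s \<Longrightarrow> s < k \<Longrightarrow>
        real (k - s) * T s x y = real (Suc s) * T (Suc s) x y - C s x y"
    and Tz: "\<And>s x y. \<forall>i<k. C i x y = 0 \<Longrightarrow> T s x y = 0"
    by (rule potential_coefficients[OF C, where k = k]) (rule that)
  have Tb: "T s w b = 0 \<and> T s b w = 0" if "w \<in> {0..1}" "b \<in> {0,1}" for s w b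
    using Tz Cx[OF _ that] Cy[OF _ that] by blast
  \<comment> \<open>For \<open>k > 1\<close> this is the recursion at the top index. For
    \<open>k = 1\<close> the left side is \<open>T 0 = 0\<close>, and \<open>C 0\<close> is zero as
    well: it vanishes on all edges, and its quotient by \<open>x * (1 - x) * y * (1 - y)\<close> has
    negative degree bounds.\<close>
  have Ttop: "T (k-1) x y = - C (k-1) x y" for x y
  proof (cases "k = 1")
    case True
    obtain g where g: "g \<in> Q2 (int k - 2) (int k - 2)"
      "\<And>x y. C 0 x y = x * (1 - x) * y * (1 - y) * g x y"
    proof (rule Q2_factor_xy[OF C[of 0]])
      show "C 0 x b = 0" if "x \<in> {0..1}" "b \<in> {0,1}" for x b
        using Cy[OF _ that] True by simp
      show "C 0 b y = 0" if "y \<in> {0..1}" "b \<in> {0,1}" for y b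
        using Cx[OF _ that] True by simp
    qed (rule that)
    have "g x y = 0" using g(1) True unfolding Q2_def by auto
    then show ?thesis using True T0 g(2) by simp
  next
    case False
    then show ?thesis using Trec[of "k-1" x y] k Tk by simp
  qed
  have "\<forall>s. \<exists>fx. fx \<in> Q2 (int k - 1) (int k) \<and> (\<forall>x y. ((\<lambda>x. T s x y) has_real_derivative fx x y) (at x))"
    using Q2_has_derivative_x[OF T] by metis
  from choice[OF this] obtain Tx where Tx: "\<And>s. Tx s \<in> Q2 (int k - 1) (int k)"
    "\<And>s x y. ((\<lambda>x. T s x y) has_real_derivative Tx s x y) (at x)" by blast
  have "\<forall>s. \<exists>fy. fy \<in> Q2 (int k) (int k - 1) \<and> (\<forall>x y. ((\<lambda>y. T s x y) has_real_derivative fy x y) (at y))"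
    using Q2_has_derivative_y[OF T] by metis
  from choice[OF this] obtain Ty where Ty: "\<And>s. Ty s \<in> Q2 (int k) (int k - 1)"
    "\<And>s x y. ((\<lambda>y. T s x y) has_real_derivative Ty s x y) (at y)" by blast
  \<comment> \<open>Differentiating \<open>Ttop\<close> and comparing with the derivatives of
    \<open>C (k-1)\<close>: the special term and the leading part of the gradient come from the same
    polynomial.\<close>
  have top: "A k x y = Tx (k-1) x y" "B k x y = Ty (k-1) x y" for x y
    using DERIV_unique[OF DERIV_minus[OF Ck(1), of y x] Tx(2)[of "k-1" y x, unfolded Ttop]]
      DERIV_unique[OF DERIV_minus[OF Ck(2), of x y] Ty(2)[of "k-1" x y, unfolded Ttop]] by simp_all
  obtain g1 where g1: "\<And>s. g1 s \<in> Q2 (int k - 1) (int k - 2)"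
    "\<And>x y z. x \<in> {0..1} \<Longrightarrow> y \<in> {0..1} \<Longrightarrow>
      (\<Sum>s<Suc k. A s x y * z^s) - (1 + z) * (\<Sum>s<k. Tx s x y * z^s)
        = y * (1 - y) * z * (\<Sum>s<k-1. g1 s x y * z^s)"
  proof (rule trace_zero_component[where A = A and T = T and Tx = Tx, OF k A T Tx T0 top(1)])
    show "T s x b = 0" if "x \<in> {0..1}" "b \<in> {0,1}" for s x b
      using Tb[OF that] by (rule conjunct1)
    show "A s x b = 0" if "s < Suc k" "x \<in> {0..1}" "b \<in> {0,1}" for s x b
      using that by (rule Ay)
    show "A 0 x y = 0" if "x \<in> {0..1}" "y \<in> {0..1}" for x y
      using AB0[OF that] by (rule conjunct1)
  qed (rule that)
  have T0': "(\<lambda>x y. T 0 y x) = (\<lambda>x y. 0)" by (simp add: T0)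
  \<comment> \<open>The roles of \<open>x\<close> and \<open>y\<close> are exchanged, so
    \<open>g2\<close> takes its arguments in reverse order; \<open>q2\<close> undoes this.\<close>
  obtain g2 where g2: "\<And>s. g2 s \<in> Q2 (int k - 1) (int k - 2)"
    "\<And>x y z. x \<in> {0..1} \<Longrightarrow> y \<in> {0..1} \<Longrightarrow>
      (\<Sum>s<Suc k. B s y x * z^s) - (1 + z) * (\<Sum>s<k. Ty s y x * z^s)
        = y * (1 - y) * z * (\<Sum>s<k-1. g2 s x y * z^s)"
  proof (rule trace_zero_component[where A = "\<lambda>s x y. B s y x" and T = "\<lambda>s x y. T s y x" and Tx = "\<lambda>s x y. Ty s y x",
        OF k Q2_swap[OF B] Q2_swap[OF T] Q2_swap[OF Ty(1)] Ty(2) T0' top(2)])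
    show "T s b x = 0" if "x \<in> {0..1}" "b \<in> {0,1}" for s x b
      using Tb[OF that] by (rule conjunct2)
    show "B s b x = 0" if "s < Suc k" "x \<in> {0..1}" "b \<in> {0,1}" for s x b
      using that by (rule Bx)
    show "B 0 y x = 0" if "x \<in> {0..1}" "y \<in> {0..1}" for x y
      using AB0[OF that(2,1)] by (rule conjunct2)
  qed (rule that)
  \<comment> \<open>\<open>C 0 - T 1\<close> is what the degree 0 equation leaves over: since
    \<open>T 0\<close> is zero, the vertical derivative of the potential contributes only
    \<open>T 1\<close> in that degree.\<close>
  obtain g3 where g3: "g3 \<in> Q2 (int k - 2) (int k - 2)"
    "\<And>x y. 1 * C 0 x y + (-1) * T 1 x y = x * (1 - x) * y * (1 - y) * g3 x y"
  proof (rule Q2_factor_xy[OF Q2_lincomb[OF C[of 0] T[of 1], of 1 "-1"]])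
    show "1 * C 0 x b + (-1) * T 1 x b = 0" if "x \<in> {0..1}" "b \<in> {0,1}" for x b
      using Cy[OF _ that] Tb[OF that] k by simp
    show "1 * C 0 b y + (-1) * T 1 b y = 0" if "y \<in> {0..1}" "b \<in> {0,1}" for y b
      using Cx[OF _ that] Tb[OF that] k by simp
  qed (rule that)
  obtain G where G: "has_gradient_on (potential k T) G (pyramid - {apex})"
    "\<And>p i. p \<in> pyramid_inf \<Longrightarrow>
       ((\<lambda>t. potential_inf k T (p + t *\<^sub>R axis i 1)) has_real_derivative pullback1 phi G p $ i) (at 0)"
    by (rule potential_gradient[OF T]) (rule that)
  define q1 where "q1 p = (\<Sum>s<k-1. g1 s (p$1) (p$2) * (p$3)^s) / (1 + p$3)^(k+1)" for p :: "real^3"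
  define q2 where "q2 p = (\<Sum>s<k-1. g2 s (p$2) (p$1) * (p$3)^s) / (1 + p$3)^(k+1)" for p :: "real^3"
  define \<rho> where "\<rho> p = g3 (p$1) (p$2) / (1 + p$3)^(k+1)" for p :: "real^3"
  have n: "nat (int k - 2 + 1) = k - 1" by linarith
  have q1: "q1 \<in> Qw (k + 1) (int k - 1) (int k - 2) (int k - 2)"
    using polyfun_z_in_Q[where c = g1, OF g1(1), where n = "int k - 2"]
    unfolding q1_def[abs_def] n by (rule Qw_I)
  have q2: "q2 \<in> Qw (k + 1) (int k - 2) (int k - 1) (int k - 2)"
    using polyfun_z_in_Q[where c = "\<lambda>s x y. g2 s y x", OF Q2_swap[OF g2(1)], where n = "int k - 2"]
    unfolding q2_def[abs_def] n by (rule Qw_I)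
  have \<rho>: "\<rho> \<in> Qw (k + 1) (int k - 2) (int k - 2) 0"
  proof -
    have "(\<lambda>p. g3 (p$1) (p$2)) \<in> Q (int k - 2) (int k - 2) 0"
      using polyfun_z_in_Q[where c = "\<lambda>s. g3", OF g3(1), where n = 0] by simp
    then show ?thesis unfolding \<rho>_def[abs_def] by (rule Qw_I)
  qed
  define W :: "real^3 \<Rightarrow> real^3" where
    "W = (\<lambda>p. vector [p$2 * (1 - p$2) * p$3 * q1 p, p$1 * (1 - p$1) * p$3 * q2 p,
      p$1 * (1 - p$1) * p$2 * (1 - p$2) * \<rho> p])"
  have W: "W \<in> U1_curl0_inf k"
    unfolding U1_curl0_inf_def W_def using q1 q2 \<rho> by blast
  have pw: "pullback1 phi (\<lambda>p. v p - G p) p = W p" if p: "p \<in> pyramid_inf" for p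
  proof -
    have z: "p$3 \<ge> 0" and xy: "p$1 \<in> {0..1}" "p$2 \<in> {0..1}" using p by (auto simp: pyramid_inf_def)
    define c where "c = 1 + p$3"
    have c: "c > 0" using z by (simp add: c_def)
    have comp: "pullback1 phi (\<lambda>p. v p - G p) p $ i = E p $ i - pullback1 phi G p $ i" for i
      using vE p by (simp add: pullback1_diff_nth)
    have d: "a / c^(k+1) - b / c^k = (a - c * b) / c^(k+1)" for a b
      using c by (simp add: field_simps)
    have G1: "pullback1 phi G p $ 1 = (\<Sum>s<k. Tx s (p$1) (p$2) * (p$3)^s) / c^k"
      unfolding c_def by (rule DERIV_unique[OF G(2)[OF p] potential_inf_derivative_x[where T = T, OF Tx(2)]])
    have G2: "pullback1 phi G p $ 2 = (\<Sum>s<k. Ty s (p$1) (p$2) * (p$3)^s) / c^k"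
      unfolding c_def by (rule DERIV_unique[OF G(2)[OF p] potential_inf_derivative_y[where T = T, OF Ty(2)]])
    have G3: "pullback1 phi G p $ 3 = (\<Sum>s<k. (real (Suc s) * T (Suc s) (p$1) (p$2)
        - (real k - real s) * T s (p$1) (p$2)) * (p$3)^s) / c^(k+1)"
      unfolding c_def by (rule DERIV_unique[OF G(2)[OF p] potential_inf_derivative_z[where T = T, OF z k Tk]])
    have 1: "pullback1 phi (\<lambda>p. v p - G p) p $ 1 = W p $ 1"
      unfolding comp G1 E1 c_def[symmetric] d
      unfolding c_def g1(2)[OF xy] by (simp add: W_def q1_def)
    have 2: "pullback1 phi (\<lambda>p. v p - G p) p $ 2 = W p $ 2"
      unfolding comp G2 E2 c_def[symmetric] d
      unfolding c_def g2(2)[OF xy(2,1)] by (simp add: W_def q2_def)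
    have "(\<Sum>s<k. C s (p$1) (p$2) * (p$3)^s) - (\<Sum>s<k. (real (Suc s) * T (Suc s) (p$1) (p$2)
        - (real k - real s) * T s (p$1) (p$2)) * (p$3)^s)
      = (\<Sum>s<k. (C s (p$1) (p$2) - (real (Suc s) * T (Suc s) (p$1) (p$2)
        - (real k - real s) * T s (p$1) (p$2))) * (p$3)^s)"
      by (simp only: sum_subtractf left_diff_distrib)
    \<comment> \<open>The recursion cancels every coefficient of positive degree, and at
      \<open>s = 0\<close> the multiple of \<open>T 0\<close> is zero.\<close>
    also have "\<dots> = C 0 (p$1) (p$2) - T 1 (p$1) (p$2)"
    proof -
      have "C s (p$1) (p$2) - (real (Suc s) * T (Suc s) (p$1) (p$2)
        - (real k - real s) * T s (p$1) (p$2)) = 0" if "s \<in> {..<k} - {0}" for s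
        using Trec[of s "p$1" "p$2"] that by (simp add: of_nat_diff)
      then have "(\<Sum>s<k. (C s (p$1) (p$2) - (real (Suc s) * T (Suc s) (p$1) (p$2)
        - (real k - real s) * T s (p$1) (p$2))) * (p$3)^s)
        = (\<Sum>s\<in>{0}. (C s (p$1) (p$2) - (real (Suc s) * T (Suc s) (p$1) (p$2)
        - (real k - real s) * T s (p$1) (p$2))) * (p$3)^s)"
        by (intro sum.mono_neutral_right) (use k in auto)
      then show ?thesis by (simp add: T0)
    qed
    finally have 3: "pullback1 phi (\<lambda>p. v p - G p) p $ 3 = W p $ 3"
      unfolding comp G3 E3 c_def[symmetric] diff_divide_distrib[symmetric]
      using g3(2)[of "p$1" "p$2"] by (simp add: W_def \<rho>_def c_def)
    show ?thesis using 1 2 3 by (simp add: vec_eq_iff forall_3)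
  qed
  show thesis
  proof (rule that[OF _ _ G(1)])
    show "potential k T \<in> U0_0 k" by (rule potential_in_U0_0[where T = T]) (rule T, rule T0, erule (1) Tb)
    show "(\<lambda>p. v p - G p) \<in> U1_curl0 k"
      unfolding U1_curl0_def using W pw by blast
    show "v p = G p + (v p - G p)" for p by simp
  qed
qed

theorem lemma4p5:
  fixes k :: nat
  assumes "k \<ge> 1"
  shows "U1_0 k \<subseteq> Hcurl (interior pyramid) \<and>
    (\<forall>v \<in> U1_0 k. \<exists>q \<in> U0_0 k. \<exists>w \<in> U1_curl0 k. \<exists>g.
       has_gradient_on q g (pyramid - {apex}) \<and>
       (\<forall>p \<in> pyramid - {apex}. v p = g p + w p))"
proof (intro conjI ballI subsetI)
  fix v assume v: "v \<in> U1_0 k"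
  then show "v \<in> Hcurl (interior pyramid)"
    using U1_subset_Hcurl assms by (auto simp: U1_0_def)
  obtain q w g where "q \<in> U0_0 k" "w \<in> U1_curl0 k" "has_gradient_on q g (pyramid - {apex})"
    "\<And>p. v p = g p + w p"
    by (rule Helmholtz_decomposition[OF v assms]) (rule that)
  then show "\<exists>q \<in> U0_0 k. \<exists>w \<in> U1_curl0 k. \<exists>g.
       has_gradient_on q g (pyramid - {apex}) \<and> (\<forall>p \<in> pyramid - {apex}. v p = g p + w p)"
    by blast
qed

end
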